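(* In a pseudo-Riemannian space form, the equiaffine mean curvature of an isoparametric hypersurface having nonzero Gauss-Kronecker curvature is constant.
   Context: A space form is a pseudo-Riemannian manifold $(M,g)$ of constant curvature, of dimension $n+1$; $\hat\nabla$ is its Levi-Civita connection. The hypersurface $\Sigma$ is a co-oriented immersed hypersurface to which $g$ restricts as a pseudo-Riemannian metric. A vector field $T$ transverse to $\Sigma$ determines on $\Sigma$ an induced connection $\nabla$, a symmetric two-tensor $h$, a shape operator $S$ and a one-form $\tau$ by $\hat\nabla_XY=\nabla_XY+h(X,Y)T$ and $\hat\nabla_XT=-S(X)+\tau(X)T$ for $X,Y$ tangent to $\Sigma$. Let $E$ be the co-oriented vector field along $\Sigma$ that is $g$-orthogonal to $\Sigma$ with $|g(E,E)|=1$, with shape operator $A$. The pseudo-Riemannian principal curvatures are the eigenvalues of $A$, the Gauss-Kronecker curvature is $\det A$, and $\Sigma$ is isoparametric if its pseudo-Riemannian principal curvatures are constant. If $\det A$ is nowhere zero then $\Sigma$ is nondegenerate with respect to $\hat\nabla$ (i.e. $h$ is nondegenerate for any transversal). A torsion-free connection $\nabla$ on an $n$-manifold is aligned with respect to a pseudo-Riemannian metric $h$ if $n\,h^{PQ}\nabla_Ph_{QI}=h^{PQ}\nabla_Ih_{PQ}$, where $h^{IJ}$ is the inverse of $h_{IJ}$. For a nondegenerate co-oriented hypersurface, the equiaffine normal $\mathsf W$ determined by $\hat\nabla$ and the volume form $\mathrm{vol}_g$ is the unique co-oriented transversal such that the induced connection is aligned with respect to the induced tensor $k$ (the $h$ for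 $T=\mathsf W$) and $|\iota(\mathsf W)\mathrm{vol}_g|=|\mathrm{vol}_k|$. The equiaffine mean curvature is $\tfrac1n\operatorname{tr}S$ for the shape operator $S$ determined by $\mathsf W$. *)

theory Defs
  imports "HOL-Analysis.Analysis" "HOL-Computational_Algebra.Computational_Algebra"
begin

section \<open>Smooth maps and smooth manifolds\<close>

abbreviation deriv_at :: "('a::real_normed_vector \<Rightarrow> 'b::real_normed_vector) \<Rightarrow> 'a \<Rightarrow> 'a \<Rightarrow> 'b" where
  "deriv_at f x \<equiv> frechet_derivative f (at x)"

text \<open>\<open>Ck_on k S f\<close> is meant for open \<open>S\<close>: then it says that \<open>f\<close> is of class \<open>C\<^sup>k\<close> on \<open>S\<close>.\<close>

primrec Ck_on ::
  "nat \<Rightarrow> 'a::euclidean_space set \<Rightarrow> ('a \<Rightarrow> 'b::real_normed_vector) \<Rightarrow> bool" where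
  "Ck_on 0 S f \<longleftrightarrow> continuous_on S f"
| "Ck_on (Suc k) S f \<longleftrightarrow>
     (\<forall>x\<in>S. f differentiable (at x)) \<and> (\<forall>v. Ck_on k S (\<lambda>x. deriv_at f x v))"

definition smooth_on :: "'a::euclidean_space set \<Rightarrow> ('a \<Rightarrow> 'b::real_normed_vector) \<Rightarrow> bool" where
  "smooth_on S f \<longleftrightarrow> (\<forall>k. Ck_on k S f)"

text \<open>The values of \<open>coord c\<close> outside \<open>cdom c\<close> are irrelevant. The manifold carried by an atlas
  is the union of the chart domains; it need not be all of the type, and it need not be
  connected. The atlas is not required to be maximal.\<close>

datatype ('a, 'k::finite) chart = Chart (cdom: "'a set") (coord: "'a \<Rightarrow> real^'k")

definition cimg :: "('a, 'k::finite) chart \<Rightarrow> (real^'k) set" where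
  "cimg c = coord c ` cdom c"

definition cpt :: "('a, 'k::finite) chart \<Rightarrow> real^'k \<Rightarrow> 'a" where
  "cpt c = inv_into (cdom c) (coord c)"

definition overlap :: "('a, 'k::finite) chart \<Rightarrow> ('a, 'k) chart \<Rightarrow> (real^'k) set" where
  "overlap c d = coord c ` (cdom c \<inter> cdom d)"

definition transition :: "('a, 'k::finite) chart \<Rightarrow> ('a, 'k) chart \<Rightarrow> real^'k \<Rightarrow> real^'k" where
  "transition c d = coord d \<circ> cpt c"

definition is_chart :: "('a::topological_space, 'k::finite) chart \<Rightarrow> bool" where
  "is_chart c \<longleftrightarrow>
     open (cdom c) \<and> open (cimg c) \<and> homeomorphism (cdom c) (cimg c) (coord c) (cpt c)"

definition smooth_atlas ::
  "('a::{t2_space,second_countable_topology}, 'k::finite) chart set \<Rightarrow> bool" where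
  "smooth_atlas \<A> \<longleftrightarrow>
     (\<forall>c\<in>\<A>. is_chart c) \<and> (\<forall>c\<in>\<A>. \<forall>d\<in>\<A>. smooth_on (overlap c d) (transition c d))"

definition manifold_carrier :: "('a, 'k::finite) chart set \<Rightarrow> 'a set" where
  "manifold_carrier \<A> = \<Union> (cdom ` \<A>)"


section \<open>Tensor fields and connections\<close>

text \<open>A tensor field is the family of its local expressions in the charts of an atlas, as
  (multi)linear maps on \<open>real^'k\<close> depending on the point of the chart image, subject to the
  transformation law on overlaps. Likewise a connection is the family of its Christoffel symbols
  in the charts: \<open>\<Gamma> c x u v\<close> is the vector with components \<open>\<Gamma>\<^sub>i\<^sub>j\<^sup>k u\<^sup>i v\<^sup>j\<close>, so that
  \<open>\<nabla>\<^sub>u V = DV(x) u + \<Gamma> c x u (V x)\<close>.\<close>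

type_synonym ('a, 'k) one_form = "('a, 'k) chart \<Rightarrow> real^'k \<Rightarrow> real^'k \<Rightarrow> real"
type_synonym ('a, 'k) two_tensor = "('a, 'k) chart \<Rightarrow> real^'k \<Rightarrow> real^'k \<Rightarrow> real^'k \<Rightarrow> real"
type_synonym ('a, 'k) endomorphism = "('a, 'k) chart \<Rightarrow> real^'k \<Rightarrow> real^'k \<Rightarrow> real^'k"
type_synonym ('a, 'k) connection =
  "('a, 'k) chart \<Rightarrow> real^'k \<Rightarrow> real^'k \<Rightarrow> real^'k \<Rightarrow> real^'k"

definition one_form_field :: "('a, 'k::finite) chart set \<Rightarrow> ('a, 'k) one_form \<Rightarrow> bool" where
  "one_form_field \<A> \<tau> \<longleftrightarrow>
     (\<forall>c\<in>\<A>. (\<forall>x\<in>cimg c. linear (\<tau> c x)) \<and> (\<forall>u. smooth_on (cimg c) (\<lambda>x. \<tau> c x u))) \<and>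
     (\<forall>c\<in>\<A>. \<forall>d\<in>\<A>. \<forall>x\<in>overlap c d. \<forall>u.
        \<tau> c x u = \<tau> d (transition c d x) (deriv_at (transition c d) x u))"

definition two_tensor_field :: "('a, 'k::finite) chart set \<Rightarrow> ('a, 'k) two_tensor \<Rightarrow> bool" where
  "two_tensor_field \<A> h \<longleftrightarrow>
     (\<forall>c\<in>\<A>. (\<forall>x\<in>cimg c. bilinear (h c x)) \<and> (\<forall>u v. smooth_on (cimg c) (\<lambda>x. h c x u v))) \<and>
     (\<forall>c\<in>\<A>. \<forall>d\<in>\<A>. \<forall>x\<in>overlap c d. \<forall>u v.
        h c x u v = h d (transition c d x)
          (deriv_at (transition c d) x u) (deriv_at (transition c d) x v))"

definition symmetric_tensor :: "('a, 'k::finite) chart set \<Rightarrow> ('a, 'k) two_tensor \<Rightarrow> bool" where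
  "symmetric_tensor \<A> h \<longleftrightarrow> (\<forall>c\<in>\<A>. \<forall>x\<in>cimg c. \<forall>u v. h c x u v = h c x v u)"

definition endomorphism_field ::
  "('a, 'k::finite) chart set \<Rightarrow> ('a, 'k) endomorphism \<Rightarrow> bool" where
  "endomorphism_field \<A> S \<longleftrightarrow>
     (\<forall>c\<in>\<A>. (\<forall>x\<in>cimg c. linear (S c x)) \<and> (\<forall>u. smooth_on (cimg c) (\<lambda>x. S c x u))) \<and>
     (\<forall>c\<in>\<A>. \<forall>d\<in>\<A>. \<forall>x\<in>overlap c d. \<forall>u.
        deriv_at (transition c d) x (S c x u) =
          S d (transition c d x) (deriv_at (transition c d) x u))"

text \<open>The last summand in the transformation law is the second derivative of the transition map;
  it is what makes \<open>\<nabla>\<^sub>u V\<close> transform as a vector.\<close>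

definition affine_connection :: "('a, 'k::finite) chart set \<Rightarrow> ('a, 'k) connection \<Rightarrow> bool" where
  "affine_connection \<A> \<Gamma> \<longleftrightarrow>
     (\<forall>c\<in>\<A>. (\<forall>x\<in>cimg c. bilinear (\<Gamma> c x)) \<and> (\<forall>u v. smooth_on (cimg c) (\<lambda>x. \<Gamma> c x u v))) \<and>
     (\<forall>c\<in>\<A>. \<forall>d\<in>\<A>. \<forall>x\<in>overlap c d. \<forall>u v.
        deriv_at (transition c d) x (\<Gamma> c x u v) =
          \<Gamma> d (transition c d x)
            (deriv_at (transition c d) x u) (deriv_at (transition c d) x v) +
          deriv_at (\<lambda>y. deriv_at (transition c d) y v) x u)"

definition torsion_free :: "('a, 'k::finite) chart set \<Rightarrow> ('a, 'k) connection \<Rightarrow> bool" where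
  "torsion_free \<A> \<Gamma> \<longleftrightarrow> (\<forall>c\<in>\<A>. \<forall>x\<in>cimg c. \<forall>u v. \<Gamma> c x u v = \<Gamma> c x v u)"

text \<open>\<open>cov_deriv_tensor \<Gamma> h c x w u v\<close> is \<open>(\<nabla>\<^sub>w h)(u, v)\<close>.\<close>

definition cov_deriv_tensor ::
  "('a, 'k::finite) connection \<Rightarrow> ('a, 'k) two_tensor \<Rightarrow> ('a, 'k) chart \<Rightarrow>
   real^'k \<Rightarrow> real^'k \<Rightarrow> real^'k \<Rightarrow> real^'k \<Rightarrow> real" where
  "cov_deriv_tensor \<Gamma> h c x w u v =
     deriv_at (\<lambda>y. h c y u v) x w - h c x (\<Gamma> c x w u) v - h c x u (\<Gamma> c x w v)"

text \<open>\<open>curvature \<Gamma> c x u v w\<close> is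
  \<open>R(u, v)w = \<nabla>\<^sub>u\<nabla>\<^sub>v w - \<nabla>\<^sub>v\<nabla>\<^sub>u w - \<nabla>\<^bsub>[u,v]\<^esub> w\<close>, computed with constant-coefficient (hence commuting)
  extensions of the vectors in the chart.\<close>

definition curvature ::
  "('a, 'k::finite) connection \<Rightarrow> ('a, 'k) chart \<Rightarrow>
   real^'k \<Rightarrow> real^'k \<Rightarrow> real^'k \<Rightarrow> real^'k \<Rightarrow> real^'k" where
  "curvature \<Gamma> c x u v w =
     deriv_at (\<lambda>y. \<Gamma> c y v w) x u - deriv_at (\<lambda>y. \<Gamma> c y u w) x v
     + \<Gamma> c x u (\<Gamma> c x v w) - \<Gamma> c x v (\<Gamma> c x u w)"


section \<open>Pseudo-Riemannian space forms\<close>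

definition nondegenerate :: "('v::real_vector \<Rightarrow> 'v \<Rightarrow> real) \<Rightarrow> bool" where
  "nondegenerate b \<longleftrightarrow> (\<forall>u. (\<forall>v. b u v = 0) \<longrightarrow> u = 0)"

definition pseudo_riemannian :: "('a, 'k::finite) chart set \<Rightarrow> ('a, 'k) two_tensor \<Rightarrow> bool" where
  "pseudo_riemannian \<A> g \<longleftrightarrow>
     two_tensor_field \<A> g \<and> symmetric_tensor \<A> g \<and> (\<forall>c\<in>\<A>. \<forall>x\<in>cimg c. nondegenerate (g c x))"

definition levi_civita ::
  "('a, 'k::finite) chart set \<Rightarrow> ('a, 'k) two_tensor \<Rightarrow> ('a, 'k) connection \<Rightarrow> bool" where
  "levi_civita \<A> g \<Gamma> \<longleftrightarrow>
     affine_connection \<A> \<Gamma> \<and> torsion_free \<A> \<Gamma> \<and>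
     (\<forall>c\<in>\<A>. \<forall>x\<in>cimg c. \<forall>w u v. cov_deriv_tensor \<Gamma> g c x w u v = 0)"

text \<open>Squared area of the parallelogram spanned by \<open>u\<close> and \<open>v\<close>; it is nonzero iff they span a
  plane on which \<open>b\<close> is nondegenerate, the planes for which sectional curvature is defined.\<close>

definition area_sq :: "('v \<Rightarrow> 'v \<Rightarrow> real) \<Rightarrow> 'v \<Rightarrow> 'v \<Rightarrow> real" where
  "area_sq b u v = b u u * b v v - (b u v)\<^sup>2"

definition sectional_curvature ::
  "('a, 'k::finite) two_tensor \<Rightarrow> ('a, 'k) connection \<Rightarrow> ('a, 'k) chart \<Rightarrow>
   real^'k \<Rightarrow> real^'k \<Rightarrow> real^'k \<Rightarrow> real" where
  "sectional_curvature g \<Gamma> c x u v = g c x (curvature \<Gamma> c x u v v) u / area_sq (g c x) u v"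

definition constant_curvature ::
  "('a, 'k::finite) chart set \<Rightarrow> ('a, 'k) two_tensor \<Rightarrow> ('a, 'k) connection \<Rightarrow> bool" where
  "constant_curvature \<A> g \<Gamma> \<longleftrightarrow>
     (\<exists>\<kappa>. \<forall>c\<in>\<A>. \<forall>x\<in>cimg c. \<forall>u v. area_sq (g c x) u v \<noteq> 0 \<longrightarrow>
        sectional_curvature g \<Gamma> c x u v = \<kappa>)"

definition space_form ::
  "('a::{t2_space,second_countable_topology}, 'k::finite) chart set \<Rightarrow>
   ('a, 'k) two_tensor \<Rightarrow> ('a, 'k) connection \<Rightarrow> bool" where
  "space_form \<A> g \<Gamma> \<longleftrightarrow>
     smooth_atlas \<A> \<and> pseudo_riemannian \<A> g \<and> levi_civita \<A> g \<Gamma> \<and> constant_curvature \<A> g \<Gamma>"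


section \<open>Immersed hypersurfaces and transversals\<close>

text \<open>The hypersurface is an abstract manifold with atlas \<open>\<B>\<close>, charted on \<open>real^'n\<close>, together
  with an immersion \<open>F\<close> into the ambient manifold with atlas \<open>\<A>\<close>. The ambient manifold is charted
  on \<open>real^('n option)\<close>, since \<open>CARD('n option) = CARD('n) + 1\<close>.

  For charts \<open>c\<close> of \<open>\<B>\<close> and \<open>d\<close> of \<open>\<A>\<close>, \<open>loc F c d\<close> is the local expression of \<open>F\<close>,
  with domain \<open>ldom F c d\<close>.\<close>

definition ldom ::
  "('s \<Rightarrow> 'a) \<Rightarrow> ('s, 'n::finite) chart \<Rightarrow> ('a, 'm::finite) chart \<Rightarrow> (real^'n) set" where
  "ldom F c d = coord c ` (cdom c \<inter> F -` cdom d)"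

definition loc ::
  "('s \<Rightarrow> 'a) \<Rightarrow> ('s, 'n::finite) chart \<Rightarrow> ('a, 'm::finite) chart \<Rightarrow> real^'n \<Rightarrow> real^'m" where
  "loc F c d = coord d \<circ> F \<circ> cpt c"

definition immersion ::
  "('s::topological_space, 'n::finite) chart set \<Rightarrow> ('a::topological_space, 'm::finite) chart set \<Rightarrow>
   ('s \<Rightarrow> 'a) \<Rightarrow> bool" where
  "immersion \<B> \<A> F \<longleftrightarrow>
     F ` manifold_carrier \<B> \<subseteq> manifold_carrier \<A> \<and> continuous_on (manifold_carrier \<B>) F \<and>
     (\<forall>c\<in>\<B>. \<forall>d\<in>\<A>. smooth_on (ldom F c d) (loc F c d) \<and>
        (\<forall>x\<in>ldom F c d. inj (deriv_at (loc F c d) x)))"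

text \<open>A vector field along \<open>F\<close> (a section of the pullback of the ambient tangent bundle):
  \<open>T d p\<close> is the component vector, in the ambient chart \<open>d\<close>, of the value at \<open>p\<close>.\<close>

type_synonym ('s, 'a, 'm) along = "('a, 'm) chart \<Rightarrow> 's \<Rightarrow> real^'m"

definition field_along ::
  "('s, 'n::finite) chart set \<Rightarrow> ('a, 'm::finite) chart set \<Rightarrow> ('s \<Rightarrow> 'a) \<Rightarrow>
   ('s, 'a, 'm) along \<Rightarrow> bool" where
  "field_along \<B> \<A> F T \<longleftrightarrow>
     (\<forall>c\<in>\<B>. \<forall>d\<in>\<A>. smooth_on (ldom F c d) (\<lambda>x. T d (cpt c x))) \<and>
     (\<forall>d\<in>\<A>. \<forall>e\<in>\<A>. \<forall>p\<in>manifold_carrier \<B>. F p \<in> cdom d \<inter> cdom e \<longrightarrow>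
        T e p = deriv_at (transition d e) (coord d (F p)) (T d p))"

definition transversal ::
  "('s, 'n::finite) chart set \<Rightarrow> ('a, 'm::finite) chart set \<Rightarrow> ('s \<Rightarrow> 'a) \<Rightarrow>
   ('s, 'a, 'm) along \<Rightarrow> bool" where
  "transversal \<B> \<A> F T \<longleftrightarrow>
     field_along \<B> \<A> F T \<and>
     (\<forall>c\<in>\<B>. \<forall>d\<in>\<A>. \<forall>x\<in>ldom F c d. T d (cpt c x) \<notin> range (deriv_at (loc F c d) x))"

text \<open>A co-orientation (orientation of the normal line bundle \<open>F\<^sup>*TM/T\<Sigma>\<close>) is represented by a
  transversal \<open>N\<close>. A field \<open>T\<close> is co-oriented if modulo tangent vectors it is everywhere a
  positive multiple of \<open>N\<close>.\<close>

definition co_oriented ::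
  "('s, 'n::finite) chart set \<Rightarrow> ('a, 'm::finite) chart set \<Rightarrow> ('s \<Rightarrow> 'a) \<Rightarrow>
   ('s, 'a, 'm) along \<Rightarrow> ('s, 'a, 'm) along \<Rightarrow> bool" where
  "co_oriented \<B> \<A> F N T \<longleftrightarrow>
     (\<forall>c\<in>\<B>. \<forall>d\<in>\<A>. \<forall>x\<in>ldom F c d. \<exists>a>0. \<exists>u.
        T d (cpt c x) = a *\<^sub>R N d (cpt c x) + deriv_at (loc F c d) x u)"

definition hypersurface ::
  "('s::{t2_space,second_countable_topology}, 'n::finite) chart set \<Rightarrow>
   ('a::{t2_space,second_countable_topology}, 'n option) chart set \<Rightarrow>
   ('a, 'n option) two_tensor \<Rightarrow> ('s \<Rightarrow> 'a) \<Rightarrow> ('s, 'a, 'n option) along \<Rightarrow> bool" where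
  "hypersurface \<B> \<A> g F N \<longleftrightarrow>
     smooth_atlas \<B> \<and> immersion \<B> \<A> F \<and> transversal \<B> \<A> F N \<and>
     (\<forall>c\<in>\<B>. \<forall>d\<in>\<A>. \<forall>x\<in>ldom F c d.
        nondegenerate (\<lambda>u v. g d (loc F c d x) (deriv_at (loc F c d) x u) (deriv_at (loc F c d) x v)))"

text \<open>The ambient covariant derivative, in the tangential direction \<open>u\<close>, of a vector field along
  \<open>F\<close> whose local expression is \<open>V\<close>.\<close>

definition cov_along ::
  "('a, 'm::finite) connection \<Rightarrow> ('s \<Rightarrow> 'a) \<Rightarrow> ('s, 'n::finite) chart \<Rightarrow> ('a, 'm) chart \<Rightarrow>
   (real^'n \<Rightarrow> real^'m) \<Rightarrow> real^'n \<Rightarrow> real^'n \<Rightarrow> real^'m" where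
  "cov_along \<Gamma> F c d V x u =
     deriv_at V x u + \<Gamma> d (loc F c d x) (deriv_at (loc F c d) x u) (V x)"

text \<open>The induced connection \<open>\<gamma>\<close>, two-tensor \<open>h\<close>, shape operator \<open>S\<close> and one-form \<open>\<tau>\<close>
  of a transversal \<open>T\<close>. The two equations are the Gauss and Weingarten formulas; \<open>Y\<close> ranges over
  the local tangent vector fields.\<close>

definition induced_data ::
  "('s, 'n::finite) chart set \<Rightarrow> ('a, 'm::finite) chart set \<Rightarrow> ('a, 'm) connection \<Rightarrow>
   ('s \<Rightarrow> 'a) \<Rightarrow> ('s, 'a, 'm) along \<Rightarrow> ('s, 'n) connection \<Rightarrow> ('s, 'n) two_tensor \<Rightarrow>
   ('s, 'n) endomorphism \<Rightarrow> ('s, 'n) one_form \<Rightarrow> bool" where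
  "induced_data \<B> \<A> \<Gamma> F T \<gamma> h S \<tau> \<longleftrightarrow>
     affine_connection \<B> \<gamma> \<and> two_tensor_field \<B> h \<and> symmetric_tensor \<B> h \<and>
     endomorphism_field \<B> S \<and> one_form_field \<B> \<tau> \<and>
     (\<forall>c\<in>\<B>. \<forall>d\<in>\<A>. \<forall>x\<in>ldom F c d. \<forall>u.
        (\<forall>Y. smooth_on (ldom F c d) Y \<longrightarrow>
           cov_along \<Gamma> F c d (\<lambda>y. deriv_at (loc F c d) y (Y y)) x u =
             deriv_at (loc F c d) x (deriv_at Y x u + \<gamma> c x u (Y x))
             + h c x u (Y x) *\<^sub>R T d (cpt c x)) \<and>
        cov_along \<Gamma> F c d (\<lambda>y. T d (cpt c y)) x u =
          - deriv_at (loc F c d) x (S c x u) + \<tau> c x u *\<^sub>R T d (cpt c x))"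

definition shape_operator ::
  "('s, 'n::finite) chart set \<Rightarrow> ('a, 'm::finite) chart set \<Rightarrow> ('a, 'm) connection \<Rightarrow>
   ('s \<Rightarrow> 'a) \<Rightarrow> ('s, 'a, 'm) along \<Rightarrow> ('s, 'n) endomorphism \<Rightarrow> bool" where
  "shape_operator \<B> \<A> \<Gamma> F T S \<longleftrightarrow> (\<exists>\<gamma> h \<tau>. induced_data \<B> \<A> \<Gamma> F T \<gamma> h S \<tau>)"


section \<open>Pseudo-Riemannian geometry of the hypersurface\<close>

definition unit_normal ::
  "('s, 'n::finite) chart set \<Rightarrow> ('a, 'm::finite) chart set \<Rightarrow> ('a, 'm) two_tensor \<Rightarrow>
   ('s \<Rightarrow> 'a) \<Rightarrow> ('s, 'a, 'm) along \<Rightarrow> ('s, 'a, 'm) along \<Rightarrow> bool" where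
  "unit_normal \<B> \<A> g F N E \<longleftrightarrow>
     field_along \<B> \<A> F E \<and> co_oriented \<B> \<A> F N E \<and>
     (\<forall>c\<in>\<B>. \<forall>d\<in>\<A>. \<forall>x\<in>ldom F c d.
        (\<forall>u. g d (loc F c d x) (E d (cpt c x)) (deriv_at (loc F c d) x u) = 0) \<and>
        \<bar>g d (loc F c d x) (E d (cpt c x)) (E d (cpt c x))\<bar> = 1)"

definition charpoly :: "real^'n^'n \<Rightarrow> complex poly" where
  "charpoly M = det (\<chi> i j. (if i = j then [:0, 1:] else 0) - [:complex_of_real (M $ i $ j):])"

text \<open>The principal curvatures at a point: the eigenvalues of \<open>A\<close>, with algebraic multiplicity.
  They may be non-real, since the induced metric, for which \<open>A\<close> is self-adjoint, may be
  indefinite.\<close>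

definition principal_curvatures ::
  "('s, 'n::finite) endomorphism \<Rightarrow> ('s, 'n) chart \<Rightarrow> real^'n \<Rightarrow> complex multiset" where
  "principal_curvatures A c x = proots (charpoly (matrix (A c x)))"

definition isoparametric :: "('s, 'n::finite) chart set \<Rightarrow> ('s, 'n) endomorphism \<Rightarrow> bool" where
  "isoparametric \<B> A \<longleftrightarrow> (\<exists>\<Lambda>. \<forall>c\<in>\<B>. \<forall>x\<in>cimg c. principal_curvatures A c x = \<Lambda>)"

definition gauss_kronecker ::
  "('s, 'n::finite) endomorphism \<Rightarrow> ('s, 'n) chart \<Rightarrow> real^'n \<Rightarrow> real" where
  "gauss_kronecker A c x = det (matrix (A c x))"


section \<open>Equiaffine geometry of the hypersurface\<close>

definition gram :: "(real^'k \<Rightarrow> real^'k \<Rightarrow> real) \<Rightarrow> real^'k^'k" where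
  "gram b = (\<chi> i j. b (axis i 1) (axis j 1))"

text \<open>\<open>n h\<^sup>P\<^sup>Q \<nabla>\<^sub>P h\<^sub>Q\<^sub>I = h\<^sup>P\<^sup>Q \<nabla>\<^sub>I h\<^sub>P\<^sub>Q\<close>, where \<open>h\<^sup>P\<^sup>Q\<close> is the inverse matrix of the components \<open>h\<^sub>P\<^sub>Q\<close>.\<close>

definition aligned ::
  "('s, 'n::finite) chart set \<Rightarrow> ('s, 'n) connection \<Rightarrow> ('s, 'n) two_tensor \<Rightarrow> bool" where
  "aligned \<B> \<gamma> h \<longleftrightarrow>
     torsion_free \<B> \<gamma> \<and>
     (\<forall>c\<in>\<B>. \<forall>x\<in>cimg c. \<forall>i.
        real CARD('n) * (\<Sum>p\<in>UNIV. \<Sum>q\<in>UNIV. matrix_inv (gram (h c x)) $ p $ q *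
            cov_deriv_tensor \<gamma> h c x (axis p 1) (axis q 1) (axis i 1)) =
        (\<Sum>p\<in>UNIV. \<Sum>q\<in>UNIV. matrix_inv (gram (h c x)) $ p $ q *
            cov_deriv_tensor \<gamma> h c x (axis i 1) (axis p 1) (axis q 1)))"

text \<open>\<open>abs_vol b vs\<close> is \<open>|vol\<^sub>b(vs)|\<close>, for the volume density
  \<open>|vol\<^sub>b| = |det b\<^sub>i\<^sub>j|\<^sup>1\<^sup>/\<^sup>2 |dx\<^sup>1 \<and> \<dots> \<and> dx\<^sup>k|\<close> of a bilinear form \<open>b\<close>.\<close>

definition abs_vol :: "(real^'k \<Rightarrow> real^'k \<Rightarrow> real) \<Rightarrow> ('k::finite \<Rightarrow> real^'k) \<Rightarrow> real" where
  "abs_vol b vs = sqrt \<bar>det (gram b)\<bar> * \<bar>det (\<chi> i. vs i)\<bar>"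

text \<open>\<open>|\<iota>(W) vol\<^sub>g| = |vol\<^sub>k|\<close> as densities on the hypersurface. \<open>case_option w vs\<close> is the family
  \<open>w, vs\<close> indexed by \<open>'n option\<close>.\<close>

definition volume_normalized ::
  "('s, 'n::finite) chart set \<Rightarrow> ('a, 'n option) chart set \<Rightarrow> ('a, 'n option) two_tensor \<Rightarrow>
   ('s \<Rightarrow> 'a) \<Rightarrow> ('s, 'a, 'n option) along \<Rightarrow> ('s, 'n) two_tensor \<Rightarrow> bool" where
  "volume_normalized \<B> \<A> g F W k \<longleftrightarrow>
     (\<forall>c\<in>\<B>. \<forall>d\<in>\<A>. \<forall>x\<in>ldom F c d. \<forall>vs.
        abs_vol (g d (loc F c d x))
          (case_option (W d (cpt c x)) (\<lambda>i. deriv_at (loc F c d) x (vs i))) =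
        abs_vol (k c x) vs)"

definition equiaffine_normal ::
  "('s, 'n::finite) chart set \<Rightarrow> ('a, 'n option) chart set \<Rightarrow> ('a, 'n option) two_tensor \<Rightarrow>
   ('a, 'n option) connection \<Rightarrow> ('s \<Rightarrow> 'a) \<Rightarrow> ('s, 'a, 'n option) along \<Rightarrow>
   ('s, 'a, 'n option) along \<Rightarrow> bool" where
  "equiaffine_normal \<B> \<A> g \<Gamma> F N W \<longleftrightarrow>
     transversal \<B> \<A> F W \<and> co_oriented \<B> \<A> F N W \<and>
     (\<exists>\<gamma> k S \<tau>. induced_data \<B> \<A> \<Gamma> F W \<gamma> k S \<tau> \<and> aligned \<B> \<gamma> k \<and>
        volume_normalized \<B> \<A> g F W k)"

text \<open>This is the equiaffine mean curvature if \<open>S\<close> is the shape operator of the equiaffine normal.\<close>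

definition mean_curvature ::
  "('s, 'n::finite) endomorphism \<Rightarrow> ('s, 'n) chart \<Rightarrow> real^'n \<Rightarrow> real" where
  "mean_curvature S c x = trace (matrix (S c x)) / real CARD('n)"

end

theory Submission
  imports Defs
begin

text \<open>Write the equiaffine normal as \<open>W = f E + U\<close> with \<open>f > 0\<close> and \<open>U\<close> tangent. The volume
  normalization gives \<open>f\<^sup>n\<^sup>+\<^sup>2 = |det A|\<close>, so \<open>f\<close> is constant, and the tensor induced by \<open>W\<close> is
  \<open>k = h / f\<close>, where \<open>h\<close> is the second fundamental form. With \<open>D\<close> the Levi-Civita connection of
  \<open>\<Sigma>\<close>, the induced connection is \<open>D - k \<otimes> U\<close>. By the Codazzi equation \<open>D k\<close> is totally symmetric, and
  its \<open>k\<close>-trace is \<open>tr (A\<^sup>-\<^sup>1 D A) = d log |det A| = 0\<close>. Hence alignment reduces to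
  \<open>(n - 1)(n + 2) k(U, -) = 0\<close>, so \<open>U = 0\<close>, \<open>W = f E\<close> and the shape operator of \<open>W\<close> is \<open>f A\<close>.\<close>

section \<open>Smooth maps on open sets\<close>

lemma Ck_on_subset: "Ck_on k S f \<Longrightarrow> T \<subseteq> S \<Longrightarrow> Ck_on k T f"
  by (induction k arbitrary: f) (auto intro: continuous_on_subset)

lemma smooth_on_subset: "smooth_on S f \<Longrightarrow> T \<subseteq> S \<Longrightarrow> smooth_on T f"
  by (auto simp: smooth_on_def intro: Ck_on_subset)

lemma smooth_on_deriv_at: "smooth_on S f \<Longrightarrow> smooth_on S (\<lambda>x. deriv_at f x v)"
  unfolding smooth_on_def by (metis Ck_on.simps(2))

lemma smooth_on_has_derivative:
  "smooth_on S f \<Longrightarrow> x \<in> S \<Longrightarrow> (f has_derivative deriv_at f x) (at x)"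
  unfolding smooth_on_def by (metis Ck_on.simps(2) frechet_derivative_works)

lemma smooth_on_continuous_on: "smooth_on S f \<Longrightarrow> continuous_on S f"
  unfolding smooth_on_def by (metis Ck_on.simps(1))

lemma smooth_on_const: "smooth_on S (\<lambda>_. a)"
proof -
  have "Ck_on k S (\<lambda>_. a)" for k
    by (induction k arbitrary: a) auto
  then show ?thesis
    by (simp add: smooth_on_def)
qed

lemma deriv_at_eq: "(f has_derivative f') (at x) \<Longrightarrow> deriv_at f x = f'"
  by (metis frechet_derivative_at)

lemma deriv_at_cong_open:
  assumes "open S" "x \<in> S" "\<And>y. y \<in> S \<Longrightarrow> f y = h y"
  shows "deriv_at f x = deriv_at h x"
proof -
  have "(f has_derivative D) (at x) \<longleftrightarrow> (h has_derivative D) (at x)" for D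
    using assms by (metis has_derivative_transform_within_open)
  then show ?thesis
    by (simp add: frechet_derivative_def)
qed

lemma mixed_difference_quotient:
  fixes f :: "'a::real_normed_vector \<Rightarrow> real"
  assumes "open S" "x \<in> S"
    and f: "\<And>y. y \<in> S \<Longrightarrow> (f has_derivative f1 y) (at y)"
    and fu: "\<And>y. y \<in> S \<Longrightarrow> ((\<lambda>y. f1 y u) has_derivative f2 y) (at y)"
    and cont: "continuous_on S (\<lambda>y. f2 y w)"
  shows "((\<lambda>t. (f (x + t *\<^sub>R u + t *\<^sub>R w) - f (x + t *\<^sub>R u) - f (x + t *\<^sub>R w) + f x) / t\<^sup>2)
            \<longlongrightarrow> f2 x w) (at_right 0)"
proof (rule tendstoI)
  fix \<epsilon> :: real assume "\<epsilon> > 0"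
  have "isCont (\<lambda>y. f2 y w) x"
    using cont assms(1,2) by (simp add: continuous_on_eq_continuous_at)
  then obtain r1 where r1: "r1 > 0" "\<And>y. dist y x < r1 \<Longrightarrow> dist (f2 y w) (f2 x w) < \<epsilon>"
    using \<open>\<epsilon> > 0\<close> unfolding continuous_at_eps_delta by (metis dist_commute)
  obtain r2 where r2: "r2 > 0" "ball x r2 \<subseteq> S"
    using assms(1,2) openE by blast
  define r where "r = min r1 r2"
  define d where "d = r / (norm u + norm w + 1)"
  have nz: "norm u + norm w + 1 > 0"
    by (smt (verit) norm_ge_zero)
  have "r > 0"
    using r1 r2 by (simp add: r_def)
  then have "d > 0"
    using nz by (simp add: d_def)
  have near: "dist (x + a *\<^sub>R u + b *\<^sub>R w) x < r" if "0 \<le> a" "a < d" "0 \<le> b" "b < d" for a b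
  proof -
    have "dist (x + a *\<^sub>R u + b *\<^sub>R w) x = norm (a *\<^sub>R u + b *\<^sub>R w)"
      by (simp add: dist_norm add.assoc)
    also have "\<dots> \<le> a * norm u + b * norm w"
      using norm_triangle_ineq[of "a *\<^sub>R u" "b *\<^sub>R w"] that by simp
    also have "\<dots> \<le> d * norm u + d * norm w"
      using that by (intro add_mono mult_right_mono) auto
    also have "\<dots> < d * (norm u + norm w + 1)"
      using \<open>d > 0\<close> by (simp add: algebra_simps)
    also have "\<dots> = r"
      using nz by (simp add: d_def)
    finally show ?thesis .
  qed
  have inS: "x + a *\<^sub>R u + b *\<^sub>R w \<in> S" if "0 \<le> a" "a < d" "0 \<le> b" "b < d" for a b
    using near[OF that] r2 by (auto simp: r_def dist_commute subset_iff)
  have "dist ((f (x + t *\<^sub>R u + t *\<^sub>R w) - f (x + t *\<^sub>R u) - f (x + t *\<^sub>R w) + f x) / t\<^sup>2) (f2 x w) < \<epsilon>"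
    if t: "0 < t" "t < d" for t
  proof -
    define \<psi> where "\<psi> = (\<lambda>s. f (x + s *\<^sub>R u + t *\<^sub>R w) - f (x + s *\<^sub>R u))"
    have "(\<psi> has_derivative (\<lambda>k. k * (f1 (x + s *\<^sub>R u + t *\<^sub>R w) u - f1 (x + s *\<^sub>R u) u))) (at s)"
      if "0 \<le> s" "s \<le> t" for s
    proof -
      have 1: "(f has_derivative f1 (x + s *\<^sub>R u + t *\<^sub>R w)) (at (x + s *\<^sub>R u + t *\<^sub>R w))"
        using f inS[of s t] that t by simp
      have 2: "(f has_derivative f1 (x + s *\<^sub>R u)) (at (x + s *\<^sub>R u))"
        using f inS[of s 0] that t by simp
      have "((\<lambda>s. f (x + s *\<^sub>R u + t *\<^sub>R w)) has_derivative (\<lambda>k. f1 (x + s *\<^sub>R u + t *\<^sub>R w) (k *\<^sub>R u))) (at s)"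
        by (rule has_derivative_compose[where g = f and f = "\<lambda>s. x + s *\<^sub>R u + t *\<^sub>R w"])
          (auto intro!: derivative_eq_intros 1)
      moreover have "((\<lambda>s. f (x + s *\<^sub>R u)) has_derivative (\<lambda>k. f1 (x + s *\<^sub>R u) (k *\<^sub>R u))) (at s)"
        by (rule has_derivative_compose[where g = f and f = "\<lambda>s. x + s *\<^sub>R u"])
          (auto intro!: derivative_eq_intros 2)
      moreover have "f1 (x + s *\<^sub>R u + t *\<^sub>R w) (k *\<^sub>R u) = k * f1 (x + s *\<^sub>R u + t *\<^sub>R w) u"
        "f1 (x + s *\<^sub>R u) (k *\<^sub>R u) = k * f1 (x + s *\<^sub>R u) u" for k
        using has_derivative_linear[OF 1] has_derivative_linear[OF 2] by (simp_all add: linear_scale)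
      ultimately show ?thesis
        unfolding \<psi>_def by (auto intro!: derivative_eq_intros simp: algebra_simps)
    qed
    then obtain \<xi> where \<xi>: "0 < \<xi>" "\<xi> < t"
      "\<psi> t - \<psi> 0 = t * (f1 (x + \<xi> *\<^sub>R u + t *\<^sub>R w) u - f1 (x + \<xi> *\<^sub>R u) u)"
      using mvt_simple[of 0 t \<psi> "\<lambda>s k. k * (f1 (x + s *\<^sub>R u + t *\<^sub>R w) u - f1 (x + s *\<^sub>R u) u)"] t
      by (force intro: has_derivative_at_withinI)
    have "((\<lambda>s. f1 (x + \<xi> *\<^sub>R u + s *\<^sub>R w) u) has_derivative
        (\<lambda>k. k * f2 (x + \<xi> *\<^sub>R u + s *\<^sub>R w) w)) (at s)" if "0 \<le> s" "s \<le> t" for s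
    proof -
      have 1: "((\<lambda>y. f1 y u) has_derivative f2 (x + \<xi> *\<^sub>R u + s *\<^sub>R w)) (at (x + \<xi> *\<^sub>R u + s *\<^sub>R w))"
        using fu inS[of \<xi> s] that t \<xi> by simp
      have "((\<lambda>s. f1 (x + \<xi> *\<^sub>R u + s *\<^sub>R w) u) has_derivative
          (\<lambda>k. f2 (x + \<xi> *\<^sub>R u + s *\<^sub>R w) (k *\<^sub>R w))) (at s)"
        by (rule has_derivative_compose[where g = "\<lambda>y. f1 y u" and
              f = "\<lambda>s. x + \<xi> *\<^sub>R u + s *\<^sub>R w"])
          (auto intro!: derivative_eq_intros 1)
      then show ?thesis
        using has_derivative_linear[OF 1] by (simp add: linear_scale)
    qed
    then obtain \<eta> where \<eta>: "0 < \<eta>" "\<eta> < t"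
      "f1 (x + \<xi> *\<^sub>R u + t *\<^sub>R w) u - f1 (x + \<xi> *\<^sub>R u) u = t * f2 (x + \<xi> *\<^sub>R u + \<eta> *\<^sub>R w) w"
      using mvt_simple[of 0 t "\<lambda>s. f1 (x + \<xi> *\<^sub>R u + s *\<^sub>R w) u"
          "\<lambda>s k. k * f2 (x + \<xi> *\<^sub>R u + s *\<^sub>R w) w"] t
      by (force intro: has_derivative_at_withinI)
    have "f (x + t *\<^sub>R u + t *\<^sub>R w) - f (x + t *\<^sub>R u) - f (x + t *\<^sub>R w) + f x = \<psi> t - \<psi> 0"
      by (simp add: \<psi>_def)
    also have "\<dots> = t\<^sup>2 * f2 (x + \<xi> *\<^sub>R u + \<eta> *\<^sub>R w) w"
      using \<xi>(3) \<eta>(3) by (simp add: power2_eq_square)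
    finally have "(f (x + t *\<^sub>R u + t *\<^sub>R w) - f (x + t *\<^sub>R u) - f (x + t *\<^sub>R w) + f x) / t\<^sup>2
        = f2 (x + \<xi> *\<^sub>R u + \<eta> *\<^sub>R w) w"
      using t by simp
    then show ?thesis
      using r1(2) near[of \<xi> \<eta>] \<xi> \<eta> t by (simp add: r_def)
  qed
  then show "\<forall>\<^sub>F t in at_right 0. dist ((f (x + t *\<^sub>R u + t *\<^sub>R w) - f (x + t *\<^sub>R u)
      - f (x + t *\<^sub>R w) + f x) / t\<^sup>2) (f2 x w) < \<epsilon>"
    using \<open>d > 0\<close> by (auto simp: eventually_at_right)
qed

lemma deriv_at_commute:
  fixes f :: "'a::euclidean_space \<Rightarrow> 'b::euclidean_space"
  assumes "open S" "x \<in> S" and f: "smooth_on S f"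
  shows "deriv_at (\<lambda>y. deriv_at f y u) x w = deriv_at (\<lambda>y. deriv_at f y w) x u"
proof (rule euclidean_eqI)
  fix b :: 'b assume "b \<in> Basis"
  have 1: "((\<lambda>y. f y \<bullet> b) has_derivative (\<lambda>v. deriv_at f y v \<bullet> b)) (at y)" if "y \<in> S" for y
    by (intro has_derivative_inner_left smooth_on_has_derivative[OF f that])
  have 2: "((\<lambda>y. deriv_at f y v \<bullet> b) has_derivative
      (\<lambda>k. deriv_at (\<lambda>y. deriv_at f y v) y k \<bullet> b)) (at y)" if "y \<in> S" for y v
    by (rule has_derivative_inner_left[OF smooth_on_has_derivative[OF smooth_on_deriv_at[OF f] that]])
  have 3: "continuous_on S (\<lambda>y. deriv_at (\<lambda>y. deriv_at f y v) y k \<bullet> b)" for v k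
    by (rule continuous_on_inner[OF smooth_on_continuous_on[OF smooth_on_deriv_at[OF smooth_on_deriv_at[OF f]]]
          continuous_on_const])
  note lim = mixed_difference_quotient[of S x "\<lambda>y. f y \<bullet> b" "\<lambda>y v. deriv_at f y v \<bullet> b" v
      "\<lambda>y k. deriv_at (\<lambda>y. deriv_at f y v) y k \<bullet> b" k for v k, OF assms(1,2) 1 2 3]
  have "((\<lambda>t. (f (x + t *\<^sub>R u + t *\<^sub>R w) \<bullet> b - f (x + t *\<^sub>R u) \<bullet> b - f (x + t *\<^sub>R w) \<bullet> b + f x \<bullet> b) / t\<^sup>2)
      \<longlongrightarrow> deriv_at (\<lambda>y. deriv_at f y w) x u \<bullet> b) (at_right 0)"
    using lim[of w u] by (simp add: algebra_simps)
  with lim[of u w] show "deriv_at (\<lambda>y. deriv_at f y u) x w \<bullet> b = deriv_at (\<lambda>y. deriv_at f y w) x u \<bullet> b"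
    by (blast intro: tendsto_unique[OF trivial_limit_at_right_real])
qed

lemma has_derivative_bilinear_field:
  fixes B :: "'x::real_normed_vector \<Rightarrow> 'a::euclidean_space \<Rightarrow> 'a \<Rightarrow> 'b::real_normed_vector"
  assumes S: "open S" "x \<in> S" and bil: "\<And>y. y \<in> S \<Longrightarrow> bilinear (B y)"
    and B: "\<And>u v. ((\<lambda>y. B y u v) has_derivative B' u v) (at x)"
    and U: "(U has_derivative U') (at x)" and V: "(V has_derivative V') (at x)"
  shows "((\<lambda>y. B y (U y) (V y)) has_derivative
           (\<lambda>k. B' (U x) (V x) k + B x (U' k) (V x) + B x (U x) (V' k))) (at x)"
proof -
  have expand: "B y u v = (\<Sum>i\<in>Basis. \<Sum>j\<in>Basis. ((u \<bullet> i) * (v \<bullet> j)) *\<^sub>R B y i j)"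
    if "y \<in> S" for y u v
    using bilinear_sum[OF bil[OF that], of "\<lambda>i. (u \<bullet> i) *\<^sub>R i" Basis "\<lambda>i. (v \<bullet> i) *\<^sub>R i" Basis]
    by (simp add: euclidean_representation bilinear_lmul[OF bil[OF that]]
        bilinear_rmul[OF bil[OF that]] sum.cartesian_product mult.commute)
  have B'_expand: "B' u v k = (\<Sum>i\<in>Basis. \<Sum>j\<in>Basis. ((u \<bullet> i) * (v \<bullet> j)) *\<^sub>R B' i j k)" for u v k
  proof -
    have "((\<lambda>y. \<Sum>i\<in>Basis. \<Sum>j\<in>Basis. ((u \<bullet> i) * (v \<bullet> j)) *\<^sub>R B y i j) has_derivative
       (\<lambda>k. \<Sum>i\<in>Basis. \<Sum>j\<in>Basis. ((u \<bullet> i) * (v \<bullet> j)) *\<^sub>R B' i j k)) (at x)"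
      by (intro has_derivative_sum has_derivative_scaleR_right B)
    then have "((\<lambda>y. B y u v) has_derivative
       (\<lambda>k. \<Sum>i\<in>Basis. \<Sum>j\<in>Basis. ((u \<bullet> i) * (v \<bullet> j)) *\<^sub>R B' i j k)) (at x)"
      by (rule has_derivative_transform_within_open[OF _ S]) (rule expand[symmetric])
    from has_derivative_unique[OF B this] show ?thesis
      by metis
  qed
  have *: "(\<lambda>k. B' (U x) (V x) k + B x (U' k) (V x) + B x (U x) (V' k)) =
      (\<lambda>k. \<Sum>i\<in>Basis. \<Sum>j\<in>Basis. ((U x \<bullet> i) * (V x \<bullet> j)) *\<^sub>R B' i j k +
         ((U x \<bullet> i) * (V' k \<bullet> j) + (U' k \<bullet> i) * (V x \<bullet> j)) *\<^sub>R B x i j)"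
    unfolding B'_expand[of "U x" "V x"] expand[OF S(2), of "U' _"] expand[OF S(2), of _ "V' _"]
    by (simp add: sum.distrib scaleR_left_distrib algebra_simps)
  have "((\<lambda>y. \<Sum>i\<in>Basis. \<Sum>j\<in>Basis. ((U y \<bullet> i) * (V y \<bullet> j)) *\<^sub>R B y i j) has_derivative
      (\<lambda>k. B' (U x) (V x) k + B x (U' k) (V x) + B x (U x) (V' k))) (at x)"
    unfolding *
    by (intro has_derivative_sum has_derivative_scaleR has_derivative_mult
        has_derivative_inner_left B U V)
  then show ?thesis
    by (rule has_derivative_transform_within_open[OF _ S]) (rule expand[symmetric])
qed

section \<open>Determinants, traces and curvature tensors\<close>

lemma coeff_prod_linear_factors:
  fixes a :: "'i \<Rightarrow> 'a::idom"
  assumes "finite I"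
  shows "degree (\<Prod>i\<in>I. [:- a i, 1:]) = card I" "coeff (\<Prod>i\<in>I. [:- a i, 1:]) (card I) = 1"
    and "I \<noteq> {} \<Longrightarrow> coeff (\<Prod>i\<in>I. [:- a i, 1:]) (card I - 1) = - (\<Sum>i\<in>I. a i)"
proof -
  show deg: "degree (\<Prod>i\<in>J. [:- a i, 1:]) = card J" for J :: "'i set"
    by (subst degree_prod_eq_sum_degree) auto
  have lead: "coeff (\<Prod>i\<in>J. [:- a i, 1:]) (card J) = 1" for J :: "'i set"
    using lead_coeff_prod[of "\<lambda>i. [:- a i, 1:]" J] by (simp add: deg)
  then show "coeff (\<Prod>i\<in>I. [:- a i, 1:]) (card I) = 1" .
  show "coeff (\<Prod>i\<in>I. [:- a i, 1:]) (card I - 1) = - (\<Sum>i\<in>I. a i)" if "I \<noteq> {}"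
    using assms that
  proof (induction rule: finite_ne_induct)
    case (insert i J)
    then have "card J = Suc (card J - 1)"
      by (metis Suc_diff_1 card_gt_0_iff)
    then have "coeff (pCons 0 (\<Prod>i\<in>J. [:- a i, 1:])) (card J) = - (\<Sum>i\<in>J. a i)"
      using insert by (metis coeff_pCons_Suc)
    then show ?case
      using insert lead[of J] by simp
  qed simp
qed

lemma permutes_two_moved:
  assumes "p permutes S" "p \<noteq> id"
  obtains i j where "i \<noteq> j" "p i \<noteq> i" "p j \<noteq> j"
proof -
  obtain i where i: "p i \<noteq> i"
    using assms(2) by (auto simp: fun_eq_iff)
  then have "p (p i) \<noteq> p i"
    using permutes_inj[OF assms(1)] by (auto dest: injD)
  with i show ?thesis
    by (metis that)
qed

lemma charpoly_coeffs:
  fixes M :: "real^'n^'n"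
  shows "degree (charpoly M) = CARD('n)" "lead_coeff (charpoly M) = 1"
    and "coeff (charpoly M) (CARD('n) - 1) = - complex_of_real (trace M)"
    and "coeff (charpoly M) 0 = (- 1) ^ CARD('n) * complex_of_real (det M)"
proof -
  let ?n = "CARD('n)"
  define T :: "('n \<Rightarrow> 'n) \<Rightarrow> complex poly" where
    "T p = (\<Prod>i\<in>UNIV. (if i = p i then [:0, 1:] else 0) - [:complex_of_real (M $ i $ p i):])" for p
  have cp: "charpoly M = (\<Sum>p | p permutes (UNIV :: 'n set). of_int (sign p) * T p)"
    by (simp add: charpoly_def det_def T_def)
  have coeff_T: "coeff (of_int (sign p) * T p) k = of_int (sign p) * coeff (T p) k" for p k
    by (simp add: of_int_poly)
  have T_id: "T id = (\<Prod>i\<in>UNIV. [:- complex_of_real (M $ i $ i), 1:])"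
    by (simp add: T_def)
  have n_pos: "?n > 0"
    by (simp add: card_gt_0_iff)
  have deg_T: "degree (T p) + 2 \<le> ?n" if p: "p permutes UNIV" "p \<noteq> id" for p
  proof -
    obtain i j where ij: "i \<noteq> j" "p i \<noteq> i" "p j \<noteq> j"
      using permutes_two_moved[OF p] .
    have "degree (T p) \<le> (\<Sum>i\<in>UNIV. degree ((if i = p i then [:0, 1:] else 0)
        - [:complex_of_real (M $ i $ p i):]))"
      unfolding T_def using degree_prod_sum_le[of "UNIV :: 'n set"] by (simp add: o_def)
    also have "\<dots> \<le> (\<Sum>i\<in>UNIV. if p i = i then 1 else 0)"
      by (intro sum_mono) auto
    also have "\<dots> = card {i. p i = i}"
      by (simp add: sum.If_cases)
    also have "\<dots> + 2 \<le> ?n"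
    proof -
      have "card {i. p i = i} \<le> card (UNIV - {i, j})"
        using ij by (intro card_mono) auto
      also have "\<dots> = ?n - 2"
        using ij by (subst card_Diff_subset) auto
      finally have "card {i. p i = i} \<le> ?n - 2" .
      moreover have "?n \<ge> card {i, j}"
        by (rule card_mono) auto
      ultimately show ?thesis
        using ij by simp
    qed
    finally show ?thesis
      by simp
  qed
  have high: "coeff (charpoly M) k = coeff (T id) k" if k: "k \<ge> ?n - 1" for k
  proof -
    have "coeff (charpoly M) k =
        (\<Sum>p | p permutes (UNIV :: 'n set). of_int (sign p) * coeff (T p) k)"
      by (simp add: cp coeff_sum coeff_T)
    also have "\<dots> = (\<Sum>p\<in>{id}. of_int (sign p) * coeff (T p) k)"
    proof (rule sum.mono_neutral_right)
      show "\<forall>p\<in>{p. p permutes (UNIV :: 'n set)} - {id}. of_int (sign p) * coeff (T p) k = 0"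
        using deg_T k by (fastforce intro: coeff_eq_0)
    qed (auto simp: permutes_id)
    finally show ?thesis
      by simp
  qed
  note lin = coeff_prod_linear_factors[of "UNIV :: 'n set" "\<lambda>i. complex_of_real (M $ i $ i)"]
  have "coeff (charpoly M) ?n = 1"
    using high[of ?n] lin(2) by (simp add: T_id)
  moreover have "degree (charpoly M) \<le> ?n"
  proof (rule degree_le, intro allI impI)
    fix k assume "k > ?n"
    then show "coeff (charpoly M) k = 0"
      using high[of k] lin(1) by (simp add: T_id coeff_eq_0)
  qed
  ultimately show deg: "degree (charpoly M) = ?n"
    by (simp add: le_antisym le_degree)
  then show "lead_coeff (charpoly M) = 1"
    using \<open>coeff (charpoly M) ?n = 1\<close> by simp
  show "coeff (charpoly M) (?n - 1) = - complex_of_real (trace M)"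
    using high[of "?n - 1"] lin(3) by (simp add: T_id trace_def)
  have "poly (T p) 0 = (- 1) ^ ?n * (\<Prod>i\<in>UNIV. complex_of_real (M $ i $ p i))" for p
    by (simp add: T_def poly_prod prod_uminus[symmetric] cong: if_cong) (rule prod.cong; simp)
  then have "poly (charpoly M) 0 = (- 1) ^ ?n * complex_of_real (det M)"
    by (simp add: cp poly_sum det_def sum_distrib_left algebra_simps)
  then show "coeff (charpoly M) 0 = (- 1) ^ ?n * complex_of_real (det M)"
    by (simp add: poly_0_coeff_0)
qed

lemma proots_charpoly_determines:
  fixes M M' :: "real^'n^'n"
  assumes "proots (charpoly M) = proots (charpoly M')"
  shows "trace M = trace M'" "det M = det M'"
proof -
  have "charpoly M = charpoly M'"
    using complex_poly_decompose_multiset[of "charpoly M"]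
      complex_poly_decompose_multiset[of "charpoly M'"]
    by (simp add: assms charpoly_coeffs(2))
  then show "trace M = trace M'" "det M = det M'"
    using charpoly_coeffs(3,4)[of M] charpoly_coeffs(3,4)[of M'] by simp_all
qed

lemma has_derivative_det_at_one:
  fixes M :: "'x::real_normed_vector \<Rightarrow> real^'n^'n"
  assumes comp: "\<And>i j. ((\<lambda>y. M y $ i $ j) has_derivative (\<lambda>h. M' h $ i $ j)) (at x)"
    and one: "M x = mat 1"
  shows "((\<lambda>y. det (M y)) has_derivative (\<lambda>h. trace (M' h))) (at x)"
proof -
  have "((\<lambda>y. det (M y)) has_derivative (\<lambda>h. \<Sum>p | p permutes (UNIV :: 'n set).
      of_int (sign p) * (\<Sum>i\<in>UNIV. M' h $ i $ p i * (\<Prod>j\<in>UNIV - {i}. M x $ j $ p j)))) (at x)"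
    unfolding det_def
    by (intro has_derivative_sum has_derivative_mult_right has_derivative_prod comp)
  moreover have "(\<Sum>p | p permutes (UNIV :: 'n set).
      of_int (sign p) * (\<Sum>i\<in>UNIV. M' h $ i $ p i * (\<Prod>j\<in>UNIV - {i}. M x $ j $ p j))) = trace (M' h)" for h
  proof -
    have "(\<Sum>p | p permutes (UNIV :: 'n set).
        of_int (sign p) * (\<Sum>i\<in>UNIV. M' h $ i $ p i * (\<Prod>j\<in>UNIV - {i}. M x $ j $ p j)))
      = (\<Sum>p\<in>{id}. of_int (sign p) * (\<Sum>i\<in>UNIV. M' h $ i $ p i * (\<Prod>j\<in>UNIV - {i}. M x $ j $ p j)))"
    proof (rule sum.mono_neutral_right, intro finite_permutations finite; (intro ballI)?)
      fix p :: "'n \<Rightarrow> 'n" assume "p \<in> {p. p permutes UNIV} - {id}"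
      then obtain i1 i2 where ij: "i1 \<noteq> i2" "p i1 \<noteq> i1" "p i2 \<noteq> i2"
        by (auto elim: permutes_two_moved)
      have "(\<Prod>j\<in>UNIV - {i}. M x $ j $ p j) = 0" for i
        using ij by (intro prod_zero bexI[of _ "if i = i1 then i2 else i1"]) (auto simp: one mat_def)
      then show "of_int (sign p) * (\<Sum>i\<in>UNIV. M' h $ i $ p i * (\<Prod>j\<in>UNIV - {i}. M x $ j $ p j)) = 0"
        by (simp only: mult_zero_right sum.neutral_const)
    qed (auto simp: permutes_id)
    then show ?thesis
      by (simp add: trace_def one mat_def)
  qed
  ultimately show ?thesis
    by simp
qed

lemma det_option_block:
  fixes M :: "'a::comm_ring_1^('n option)^('n::finite option)"
  assumes zero: "\<And>j. M $ None $ Some j = 0"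
  shows "det M = M $ None $ None * det (\<chi> i j. M $ Some i $ Some j)"
proof -
  let ?P = "{p. p permutes (range Some :: 'n option set)}"
  have bij_Some: "bij_betw Some (UNIV :: 'n set) (range Some)"
    by (simp add: inj_on_imp_bij_betw)
  have bij_perm: "bij_betw (map_permutation UNIV Some) {q. q permutes (UNIV :: 'n set)} ?P"
    using bij_betw_permutations[OF bij_Some]
    by (simp add: map_permutation_def[abs_def] restrict_id_def[abs_def] o_def)
  have "det M = (\<Sum>p\<in>?P. of_int (sign p) * (\<Prod>i\<in>UNIV. M $ i $ p i))"
    unfolding det_def
  proof (rule sum.mono_neutral_right)
    show "?P \<subseteq> {p. p permutes UNIV}"
      using permutes_subset by blast
    show "\<forall>p\<in>{p. p permutes UNIV} - ?P. of_int (sign p) * (\<Prod>i\<in>UNIV. M $ i $ p i) = 0"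
    proof
      fix p assume p: "p \<in> {p. p permutes UNIV} - ?P"
      have "p None \<noteq> None"
      proof
        assume "p None = None"
        then have fixed: "p x = x" if "x \<in> UNIV - range Some" for x
          using that by (cases x) simp_all
        have "p permutes (range Some)"
          by (rule permutes_superset[OF _ fixed]) (use p in blast)
        with p show False
          by blast
      qed
      then have "M $ None $ p None = 0"
        using zero by auto
      then have "(\<Prod>i\<in>UNIV. M $ i $ p i) = 0"
        by (intro prod_zero) auto
      then show "of_int (sign p) * (\<Prod>i\<in>UNIV. M $ i $ p i) = 0"
        by (simp only: mult_zero_right)
    qed
  qed (simp add: finite_permutations)
  also have "\<dots> = (\<Sum>q | q permutes (UNIV :: 'n set). of_int (sign (map_permutation UNIV Some q)) *
      (\<Prod>i\<in>UNIV. M $ i $ map_permutation UNIV Some q i))"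
    by (rule sum.reindex_bij_betw[symmetric]) (rule bij_perm)
  also have "\<dots> = (\<Sum>q | q permutes (UNIV :: 'n set). M $ None $ None *
      (of_int (sign q) * (\<Prod>i\<in>UNIV. M $ Some i $ Some (q i))))"
  proof (rule sum.cong[OF refl])
    fix q assume "q \<in> {q. q permutes (UNIV :: 'n set)}"
    then have q: "q permutes UNIV"
      by simp
    have N: "map_permutation UNIV Some q None = None"
      by (simp add: map_permutation_def restrict_id_def)
    have S: "map_permutation UNIV Some q (Some i) = Some (q i)" for i
      by (simp add: map_permutation_def restrict_id_def)
    have "(\<Prod>i\<in>UNIV. M $ i $ map_permutation UNIV Some q i) =
        M $ None $ None * (\<Prod>i\<in>range Some. M $ i $ map_permutation UNIV Some q i)"
      by (simp add: UNIV_option_conv N)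
    also have "(\<Prod>i\<in>range Some. M $ i $ map_permutation UNIV Some q i) = (\<Prod>i\<in>UNIV. M $ Some i $ Some (q i))"
      by (simp add: prod.reindex S)
    finally show "of_int (sign (map_permutation UNIV Some q)) *
        (\<Prod>i\<in>UNIV. M $ i $ map_permutation UNIV Some q i) =
        M $ None $ None * (of_int (sign q) * (\<Prod>i\<in>UNIV. M $ Some i $ Some (q i)))"
      using sign_map_permutation[OF _ q, of Some] by (simp add: mult_ac)
  qed
  also have "\<dots> = M $ None $ None * det (\<chi> i j. M $ Some i $ Some j)"
    by (simp add: det_def sum_distrib_left)
  finally show ?thesis .
qed

lemma bilinear_expand_left:
  fixes b :: "real^'k \<Rightarrow> real^'k \<Rightarrow> real"
  assumes "bilinear b"
  shows "b u v = (\<Sum>p\<in>UNIV. u $ p * b (axis p 1) v)"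
proof -
  have lin: "linear (\<lambda>u. b u v)"
    using assms by (simp add: bilinear_def)
  have "b u v = b (\<Sum>p\<in>UNIV. u $ p *\<^sub>R axis p 1) v"
    using basis_expansion[of u] by (simp add: scalar_mult_eq_scaleR)
  then show ?thesis
    by (simp add: linear_sum[OF lin] linear_scale[OF lin])
qed

lemma bilinear_expand_axis:
  fixes b :: "real^'k \<Rightarrow> real^'k \<Rightarrow> real"
  assumes "bilinear b"
  shows "b u v = (\<Sum>p\<in>UNIV. \<Sum>q\<in>UNIV. u $ p * v $ q * b (axis p 1) (axis q 1))"
proof -
  have flip: "bilinear (\<lambda>x y. b y x)"
    using assms by (simp add: bilinear_def)
  have "b y v = (\<Sum>q\<in>UNIV. v $ q * b y (axis q 1))" for y
    using bilinear_expand_left[OF flip, where u = v and v = y] .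
  then show ?thesis
    by (subst bilinear_expand_left[OF assms]) (simp add: sum_distrib_left mult.assoc)
qed

lemma abs_vol_conv_gram:
  fixes b :: "real^'k \<Rightarrow> real^'k \<Rightarrow> real"
  assumes "bilinear b"
  shows "abs_vol b vs = sqrt \<bar>det (\<chi> i j. b (vs i) (vs j))\<bar>"
proof -
  have "(\<chi> i j. b (vs i) (vs j)) = (\<chi> i. vs i) ** (gram b ** transpose (\<chi> i. vs i))"
    by (subst bilinear_expand_axis[OF assms])
      (simp add: vec_eq_iff matrix_matrix_mult_def transpose_def gram_def sum_distrib_left mult_ac)
  then have "det (\<chi> i j. b (vs i) (vs j)) = det (gram b) * (det (\<chi> i. vs i))\<^sup>2"
    by (simp add: det_mul power2_eq_square)
  then show ?thesis
    by (simp add: abs_vol_def abs_mult real_sqrt_mult)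
qed

lemma abs_vol_case_option:
  fixes b :: "real^('n::finite option) \<Rightarrow> real^('n option) \<Rightarrow> real"
  assumes "w \<in> span (range v)"
  shows "abs_vol b (case_option (f *\<^sub>R e + w) v) = \<bar>f\<bar> * abs_vol b (case_option e v)"
proof -
  let ?A = "\<chi> i. case_option (f *\<^sub>R e) v i"
  have "w \<in> span {row j ?A |j. j \<noteq> None}"
  proof -
    have "v i \<in> {row j ?A |j. j \<noteq> None}" for i
      by (auto simp: row_def intro!: exI[of _ "Some i"])
    then show ?thesis
      using assms span_mono[of "range v" "{row j ?A |j. j \<noteq> None}"] by blast
  qed
  from det_row_span[OF this[folded span_vec_eq]]
  have "det (\<chi> k. if k = None then row None ?A + w else row k ?A) = det ?A" .
  moreover have "(\<chi> k. if k = None then row None ?A + w else row k ?A) = (\<chi> i. case_option (f *\<^sub>R e + w) v i)"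
    by (simp add: row_def vec_eq_iff split: option.split)
  moreover have "det ?A = f * det (\<chi> i. case_option e v i)"
  proof -
    have "?A = (\<chi> i. if i = None then f *s e else case_option e v i)"
      "(\<chi> i. case_option e v i) = (\<chi> i. if i = None then e else case_option e v i)"
      by (simp_all add: vec_eq_iff scalar_mult_eq_scaleR split: option.split)
    then show ?thesis
      using det_row_mul[of None f "\<lambda>_. e" "case_option e v"] by simp
  qed
  ultimately show ?thesis
    by (simp add: abs_vol_def abs_mult)
qed

lemma det_gram_nonzero:
  fixes b :: "real^'k \<Rightarrow> real^'k \<Rightarrow> real"
  assumes "bilinear b" "\<And>u v. b u v = b v u" "nondegenerate b"
  shows "det (gram b) \<noteq> 0"
proof -
  have "u = 0" if u: "gram b *v u = 0" for u
  proof -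
    have "b v u = 0" for v
    proof -
      have "b v u = (\<Sum>p\<in>UNIV. v $ p * (gram b *v u) $ p)"
        by (subst bilinear_expand_axis[OF assms(1)])
          (simp add: matrix_vector_mult_def gram_def sum_distrib_left mult_ac)
      then show ?thesis
        by (simp add: u)
    qed
    then show ?thesis
      using assms(2,3) by (metis nondegenerate_def)
  qed
  then show ?thesis
    by (metis invertible_det_nz invertible_left_inverse matrix_left_invertible_ker)
qed

lemma metric_trace:
  fixes b :: "real^'k \<Rightarrow> real^'k \<Rightarrow> real"
  assumes b: "bilinear b" "\<And>u v. b u v = b v u" "nondegenerate b"
  shows "(\<Sum>p\<in>UNIV. \<Sum>q\<in>UNIV. matrix_inv (gram b) $ p $ q * b (C (axis p 1)) (axis q 1)) = trace (matrix C)"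
proof -
  let ?K = "gram b"
  let ?J = "matrix_inv ?K"
  have inv: "?J ** ?K = mat 1"
    using det_gram_nonzero[OF b] unfolding invertible_det_nz[symmetric] invertible_def matrix_inv_def
    by (rule someI2_ex) blast
  have "b (C (axis p 1)) (axis q 1) = (\<Sum>r\<in>UNIV. matrix C $ r $ p * ?K $ q $ r)" for p q
    unfolding bilinear_expand_left[OF b(1), of "C _"]
    by (simp add: matrix_def gram_def b(2)[of "axis q 1" "axis _ 1"])
  then have "(\<Sum>p\<in>UNIV. \<Sum>q\<in>UNIV. ?J $ p $ q * b (C (axis p 1)) (axis q 1))
     = (\<Sum>p\<in>UNIV. \<Sum>r\<in>UNIV. matrix C $ r $ p * (?J ** ?K) $ p $ r)"
    by (simp add: matrix_matrix_mult_def sum_distrib_left mult_ac) (rule sum.cong[OF refl], rule sum.swap)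
  also have "\<dots> = trace (matrix C)"
    by (simp add: inv mat_def trace_def if_distrib cong: if_cong)
  finally show ?thesis .
qed

lemma curvature_tensor_eq_0:
  fixes Q :: "'v::real_vector \<Rightarrow> 'v \<Rightarrow> 'v \<Rightarrow> 'v \<Rightarrow> real"
  assumes lin: "\<And>y z w. linear (\<lambda>x. Q x y z w)" "\<And>x z w. linear (\<lambda>y. Q x y z w)"
      "\<And>x y w. linear (\<lambda>z. Q x y z w)" "\<And>x y z. linear (\<lambda>w. Q x y z w)"
    and anti12: "\<And>x y z w. Q x y z w = - Q y x z w"
    and anti34: "\<And>x y z w. Q x y z w = - Q x y w z"
    and bianchi: "\<And>x y z w. Q x y z w + Q y z x w + Q z x y w = 0"
    and sec: "\<And>u v. Q u v v u = 0"
  shows "Q x y z w = 0"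
proof -
  note add = lin[THEN linear_add]
  have pair: "Q x y z w = Q z w x y" for x y z w
    using bianchi[of x y z w] bianchi[of y z w x] bianchi[of z w x y] bianchi[of w x y z]
      anti12[of x y z w] anti12[of y z x w] anti12[of z x y w]
      anti34[of y z w x] anti12[of z w y x] anti12[of w y z x]
      anti34[of z w x y] anti34[of w x z y] anti34[of x z w y]  anti12[of x z w y] anti12[of w x z y]
      anti34[of w x y z] anti34[of x y w z] anti34[of y w x z] anti12[of y w x z] anti34[of w y z x] anti34[of w y x z]
      anti34[of x z y w] anti34[of z w y x] anti34[of z x w y]
    by argo
  have zero: "Q u v v w = 0" for u v w
  proof -
    have "Q u v v w + Q w v v u = 0"
      using sec[of "u + w" v] unfolding add by (simp add: sec)
    moreover have "Q w v v u = Q u v v w"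
      using pair[of w v v u] anti12[of v u w v] anti34[of u v w v] by simp
    ultimately show ?thesis
      by simp
  qed
  then have skew: "Q x y z w = - Q x z y w" for x y z w
    using zero[of x "y + z" w] unfolding add by (simp add: zero)
  show ?thesis
    using bianchi[of x y z w] skew[of x y z w] skew[of y z x w] anti12[of z x y w] anti12[of y x z w] by simp
qed

lemma area_sq_eq_0_removable:
  fixes Q :: "'v::real_vector \<Rightarrow> 'v \<Rightarrow> 'v \<Rightarrow> 'v \<Rightarrow> real"
  assumes lin: "\<And>y z w. linear (\<lambda>x. Q x y z w)" "\<And>x z w. linear (\<lambda>y. Q x y z w)"
      "\<And>x y w. linear (\<lambda>z. Q x y z w)" "\<And>x y z. linear (\<lambda>w. Q x y z w)"
    and b: "bilinear b" and ex: "area_sq b u' v' \<noteq> 0"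
    and Q: "\<And>u v. area_sq b u v \<noteq> 0 \<Longrightarrow> Q u v v u = 0"
  shows "Q u v v u = 0"
proof -
  note Q_simps = lin[THEN linear_add] lin[THEN linear_scale]
  note b_simps = bilinear_ladd[OF b] bilinear_radd[OF b] bilinear_lmul[OF b] bilinear_rmul[OF b]
  define p where "p = [:Q u v v u,
    Q u' v v u + Q u v' v u + Q u v v' u + Q u v v u',
    Q u' v' v u + Q u' v v' u + Q u' v v u' + Q u v' v' u + Q u v' v u' + Q u v v' u',
    Q u' v' v' u + Q u' v' v u' + Q u' v v' u' + Q u v' v' u',
    Q u' v' v' u':]"
  have p: "poly p t = Q (u + t *\<^sub>R u') (v + t *\<^sub>R v') (v + t *\<^sub>R v') (u + t *\<^sub>R u')" for t
    by (simp add: p_def Q_simps algebra_simps)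
  define U where "U = [:b u u, b u u' + b u' u, b u' u':]"
  define V where "V = [:b v v, b v v' + b v' v, b v' v':]"
  define W where "W = [:b u v, b u v' + b u' v, b u' v':]"
  define a where "a = U * V - W * W"
  have a: "poly a t = area_sq b (u + t *\<^sub>R u') (v + t *\<^sub>R v')" for t
    by (simp add: a_def U_def V_def W_def area_sq_def b_simps power2_eq_square algebra_simps)
  have "coeff a 4 = area_sq b u' v'"
    by (simp add: a_def U_def V_def W_def area_sq_def power2_eq_square coeff_pCons numeral_eq_Suc)
  then have "a \<noteq> 0"
    using ex by auto
  moreover have "poly (p * a) t = 0" for t
    using Q[of "u + t *\<^sub>R u'" "v + t *\<^sub>R v'"] by (auto simp: p a)
  then have "p * a = 0"
    by (simp add: poly_eq_poly_eq_iff[symmetric] fun_eq_iff)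
  ultimately have "p = 0"
    by simp
  then show ?thesis
    by (simp add: p_def)
qed

section \<open>Space forms in a chart\<close>

text \<open>\<open>cov_along\<close> for an arbitrary map \<open>L\<close> into a chart, so that \<open>L\<close> may also be the identity.\<close>

definition cov_map :: "(real^'m \<Rightarrow> real^'m \<Rightarrow> real^'m \<Rightarrow> real^'m::finite) \<Rightarrow>
    ('x::euclidean_space \<Rightarrow> real^'m) \<Rightarrow> ('x \<Rightarrow> real^'m) \<Rightarrow> 'x \<Rightarrow> 'x \<Rightarrow> real^'m" where
  "cov_map G L V x u = deriv_at V x u + G (L x) (deriv_at L x u) (V x)"

locale space_form_chart =
  fixes \<A> :: "('a::{t2_space,second_countable_topology}, 'm::finite) chart set"
    and g :: "('a, 'm) two_tensor" and \<Gamma> :: "('a, 'm) connection" and d :: "('a, 'm) chart"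
  assumes space_form: "space_form \<A> g \<Gamma>" and chart: "d \<in> \<A>"
begin

lemma open_cimg: "open (cimg d)"
  using space_form chart by (auto simp: space_form_def smooth_atlas_def is_chart_def)

lemma two_tensor_g: "two_tensor_field \<A> g" and connection: "affine_connection \<A> \<Gamma>"
  using space_form by (auto simp: space_form_def pseudo_riemannian_def levi_civita_def)

lemma bilinear_g: "x \<in> cimg d \<Longrightarrow> bilinear (g d x)"
  and smooth_g: "smooth_on (cimg d) (\<lambda>x. g d x u v)"
  using two_tensor_g chart by (auto simp: two_tensor_field_def)

lemma bilinear_\<Gamma>: "x \<in> cimg d \<Longrightarrow> bilinear (\<Gamma> d x)"
  and smooth_\<Gamma>: "smooth_on (cimg d) (\<lambda>x. \<Gamma> d x u v)"
  using connection chart by (auto simp: affine_connection_def)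

lemma sym_g: "x \<in> cimg d \<Longrightarrow> g d x u v = g d x v u"
  using space_form chart
  unfolding space_form_def pseudo_riemannian_def symmetric_tensor_def by blast

lemma torsion_free: "x \<in> cimg d \<Longrightarrow> \<Gamma> d x u v = \<Gamma> d x v u"
  using space_form chart
  unfolding space_form_def levi_civita_def torsion_free_def by blast

lemma g_parallel: "x \<in> cimg d \<Longrightarrow>
    deriv_at (\<lambda>y. g d y u v) x w = g d x (\<Gamma> d x w u) v + g d x u (\<Gamma> d x w v)"
proof -
  assume "x \<in> cimg d"
  then have "cov_deriv_tensor \<Gamma> g d x w u v = 0"
    using space_form chart unfolding space_form_def levi_civita_def by blast
  then show ?thesis
    by (simp add: cov_deriv_tensor_def)
qed

lemmas g_simps =
  bilinear_g[THEN bilinear_ladd] bilinear_g[THEN bilinear_radd]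
  bilinear_g[THEN bilinear_lmul] bilinear_g[THEN bilinear_rmul]
  bilinear_g[THEN bilinear_lzero] bilinear_g[THEN bilinear_rzero]
  bilinear_g[THEN bilinear_lneg] bilinear_g[THEN bilinear_rneg]
  bilinear_g[THEN bilinear_lsub] bilinear_g[THEN bilinear_rsub]

lemmas \<Gamma>_simps =
  bilinear_\<Gamma>[THEN bilinear_ladd] bilinear_\<Gamma>[THEN bilinear_radd]
  bilinear_\<Gamma>[THEN bilinear_lmul] bilinear_\<Gamma>[THEN bilinear_rmul]

lemma has_derivative_metric_along:
  assumes S: "open S" "x \<in> S" "L ` S \<subseteq> cimg d"
    and L: "(L has_derivative deriv_at L x) (at x)"
    and V: "(V has_derivative deriv_at V x) (at x)" and W: "(W has_derivative deriv_at W x) (at x)"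
  shows "((\<lambda>y. g d (L y) (V y) (W y)) has_derivative
     (\<lambda>u. g d (L x) (cov_map (\<Gamma> d) L V x u) (W x) + g d (L x) (V x) (cov_map (\<Gamma> d) L W x u))) (at x)"
proof -
  have Lx: "L x \<in> cimg d"
    using S by auto
  have 1: "((\<lambda>y. g d (L y) u v) has_derivative (\<lambda>k. deriv_at (\<lambda>z. g d z u v) (L x) (deriv_at L x k))) (at x)"
    for u v
    by (rule has_derivative_compose[OF L smooth_on_has_derivative[OF smooth_g Lx]])
  have "((\<lambda>y. g d (L y) (V y) (W y)) has_derivative
     (\<lambda>k. deriv_at (\<lambda>z. g d z (V x) (W x)) (L x) (deriv_at L x k) +
        g d (L x) (deriv_at V x k) (W x) + g d (L x) (V x) (deriv_at W x k))) (at x)"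
    using S bilinear_g by (intro has_derivative_bilinear_field[OF S(1,2) _ 1 V W]) auto
  moreover have "deriv_at (\<lambda>z. g d z (V x) (W x)) (L x) (deriv_at L x k) +
        g d (L x) (deriv_at V x k) (W x) + g d (L x) (V x) (deriv_at W x k) =
      g d (L x) (cov_map (\<Gamma> d) L V x k) (W x) + g d (L x) (V x) (cov_map (\<Gamma> d) L W x k)" for k
    by (simp add: g_parallel[OF Lx] cov_map_def g_simps[OF Lx])
  ultimately show ?thesis
    by simp
qed

lemma has_derivative_cov_map:
  assumes S: "open S" "x \<in> S" "L ` S \<subseteq> cimg d" and L: "smooth_on S L" and V: "smooth_on S V"
  shows "((\<lambda>y. cov_map (\<Gamma> d) L V y u) has_derivative
     (\<lambda>w. deriv_at (\<lambda>y. deriv_at V y u) x w +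
       (deriv_at (\<lambda>y. \<Gamma> d y (deriv_at L x u) (V x)) (L x) (deriv_at L x w) +
        \<Gamma> d (L x) (deriv_at (\<lambda>y. deriv_at L y u) x w) (V x) +
        \<Gamma> d (L x) (deriv_at L x u) (deriv_at V x w)))) (at x)"
proof -
  have Lx: "L x \<in> cimg d"
    using S by auto
  have "((\<lambda>y. \<Gamma> d (L y) u v) has_derivative (\<lambda>k. deriv_at (\<lambda>z. \<Gamma> d z u v) (L x) (deriv_at L x k))) (at x)"
    for u v
    by (rule has_derivative_compose[OF smooth_on_has_derivative[OF L S(2)]
          smooth_on_has_derivative[OF smooth_\<Gamma> Lx]])
  then show ?thesis
    unfolding cov_map_def using S bilinear_\<Gamma>
    by (intro has_derivative_add has_derivative_bilinear_field[OF S(1,2)]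
        smooth_on_has_derivative[OF smooth_on_deriv_at[OF L] S(2)]
        smooth_on_has_derivative[OF smooth_on_deriv_at[OF V] S(2)]
        smooth_on_has_derivative[OF V S(2)]) auto
qed

lemma ricci_identity:
  assumes S: "open S" "x \<in> S" "L ` S \<subseteq> cimg d" and L: "smooth_on S L" and V: "smooth_on S V"
  shows "cov_map (\<Gamma> d) L (\<lambda>y. cov_map (\<Gamma> d) L V y u) x w - cov_map (\<Gamma> d) L (\<lambda>y. cov_map (\<Gamma> d) L V y w) x u
    = curvature \<Gamma> d (L x) (deriv_at L x w) (deriv_at L x u) (V x)"
proof -
  have Lx: "L x \<in> cimg d"
    using S by auto
  have "cov_map (\<Gamma> d) L (\<lambda>y. cov_map (\<Gamma> d) L V y u) x w =
      deriv_at (\<lambda>y. deriv_at V y u) x w +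
       (deriv_at (\<lambda>y. \<Gamma> d y (deriv_at L x u) (V x)) (L x) (deriv_at L x w) +
        \<Gamma> d (L x) (deriv_at (\<lambda>y. deriv_at L y u) x w) (V x) +
        \<Gamma> d (L x) (deriv_at L x u) (deriv_at V x w)) +
      \<Gamma> d (L x) (deriv_at L x w) (deriv_at V x u + \<Gamma> d (L x) (deriv_at L x u) (V x))" for u w
    unfolding cov_map_def[of _ _ "\<lambda>y. cov_map (\<Gamma> d) L V y u"]
      deriv_at_eq[OF has_derivative_cov_map[OF assms]] by (simp add: cov_map_def)
  then show ?thesis
    using deriv_at_commute[OF S(1,2) V, of u w] deriv_at_commute[OF S(1,2) L, of u w]
    by (simp add: curvature_def \<Gamma>_simps[OF Lx])
qed

lemma bilinear_deriv_\<Gamma>: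
  assumes x: "x \<in> cimg d"
  shows "bilinear (\<lambda>v w. deriv_at (\<lambda>y. \<Gamma> d y v w) x u)"
proof -
  note D = smooth_on_has_derivative[OF smooth_\<Gamma> x]
  have "deriv_at (\<lambda>y. \<Gamma> d y (v + v') w) x u = deriv_at (\<lambda>y. \<Gamma> d y v w) x u + deriv_at (\<lambda>y. \<Gamma> d y v' w) x u"
    "deriv_at (\<lambda>y. \<Gamma> d y w (v + v')) x u = deriv_at (\<lambda>y. \<Gamma> d y w v) x u + deriv_at (\<lambda>y. \<Gamma> d y w v') x u"
    for v v' w
    using deriv_at_cong_open[OF open_cimg x, of "\<lambda>y. \<Gamma> d y (v + v') w" "\<lambda>y. \<Gamma> d y v w + \<Gamma> d y v' w"]
      deriv_at_cong_open[OF open_cimg x, of "\<lambda>y. \<Gamma> d y w (v + v')" "\<lambda>y. \<Gamma> d y w v + \<Gamma> d y w v'"]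
      deriv_at_eq[OF has_derivative_add[OF D[of v w] D[of v' w]]]
      deriv_at_eq[OF has_derivative_add[OF D[of w v] D[of w v']]]
    by (simp_all add: \<Gamma>_simps)
  moreover have "deriv_at (\<lambda>y. \<Gamma> d y (r *\<^sub>R v) w) x u = r *\<^sub>R deriv_at (\<lambda>y. \<Gamma> d y v w) x u"
    "deriv_at (\<lambda>y. \<Gamma> d y w (r *\<^sub>R v)) x u = r *\<^sub>R deriv_at (\<lambda>y. \<Gamma> d y w v) x u"
    for r v w
    using deriv_at_cong_open[OF open_cimg x, of "\<lambda>y. \<Gamma> d y (r *\<^sub>R v) w" "\<lambda>y. r *\<^sub>R \<Gamma> d y v w"]
      deriv_at_cong_open[OF open_cimg x, of "\<lambda>y. \<Gamma> d y w (r *\<^sub>R v)" "\<lambda>y. r *\<^sub>R \<Gamma> d y w v"]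
      deriv_at_eq[OF has_derivative_scaleR_right[OF D[of v w], of r]]
      deriv_at_eq[OF has_derivative_scaleR_right[OF D[of w v], of r]]
    by (simp_all add: \<Gamma>_simps)
  ultimately show ?thesis
    by (auto simp: bilinear_def intro!: linearI)
qed

lemma linear_curvature:
  assumes x: "x \<in> cimg d"
  shows "linear (\<lambda>u. curvature \<Gamma> d x u v w)" "linear (\<lambda>v. curvature \<Gamma> d x u v w)"
    "linear (\<lambda>w. curvature \<Gamma> d x u v w)"
proof -
  note D = has_derivative_linear[OF smooth_on_has_derivative[OF smooth_\<Gamma> x]]
  note B = bilinear_deriv_\<Gamma>[OF x]
  note simps = linear_add[OF D] linear_scale[OF D] bilinear_ladd[OF B] bilinear_radd[OF B]
    bilinear_lmul[OF B] bilinear_rmul[OF B] \<Gamma>_simps[OF x]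
  show "linear (\<lambda>u. curvature \<Gamma> d x u v w)" "linear (\<lambda>v. curvature \<Gamma> d x u v w)"
    "linear (\<lambda>w. curvature \<Gamma> d x u v w)"
    by (rule linearI; simp add: curvature_def simps scaleR_add_right scaleR_diff_right)+
qed

lemma curvature_anti12: "curvature \<Gamma> d x u v w = - curvature \<Gamma> d x v u w"
  by (simp add: curvature_def)

lemma curvature_bianchi:
  assumes x: "x \<in> cimg d"
  shows "curvature \<Gamma> d x u v w + curvature \<Gamma> d x v w u + curvature \<Gamma> d x w u v = 0"
proof -
  have D: "deriv_at (\<lambda>y. \<Gamma> d y a b) x c = deriv_at (\<lambda>y. \<Gamma> d y b a) x c" for a b c
    using deriv_at_cong_open[OF open_cimg x, of "\<lambda>y. \<Gamma> d y a b" "\<lambda>y. \<Gamma> d y b a"] torsion_free by simp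
  show ?thesis
    using D[of u v w] D[of v w u] D[of w u v]
      torsion_free[OF x, of u v] torsion_free[OF x, of v w] torsion_free[OF x, of w u]
    by (simp add: curvature_def)
qed

lemma curvature_anti34:
  assumes x: "x \<in> cimg d"
  shows "g d x (curvature \<Gamma> d x a b z) w = - g d x (curvature \<Gamma> d x a b w) z"
proof -
  have id': "((\<lambda>y. y) has_derivative deriv_at (\<lambda>y::real^'m. y) y) (at y)" "deriv_at (\<lambda>y::real^'m. y) y = id" for y
    using deriv_at_eq[OF has_derivative_id, of y] by (simp_all add: id_def)
  have const: "((\<lambda>_. v) has_derivative deriv_at (\<lambda>_::real^'m. v) y) (at y)" for v :: "real^'m" and y
    using deriv_at_eq[OF has_derivative_const[of v]] by simp
  note along = has_derivative_metric_along[OF open_cimg, where L = "\<lambda>y. y", OF _ _ id'(1)]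
  have cov_const: "cov_map (\<Gamma> d) (\<lambda>y. y) (\<lambda>_. v) y u = \<Gamma> d y u v" for v y u
    by (simp add: cov_map_def id'(2))
  have "deriv_at (\<lambda>y. deriv_at (\<lambda>y. g d y z w) y b) x a =
      (g d x (cov_map (\<Gamma> d) (\<lambda>y. y) (\<lambda>y. \<Gamma> d y b z) x a) w + g d x (\<Gamma> d x b z) (\<Gamma> d x a w)) +
      (g d x (\<Gamma> d x a z) (\<Gamma> d x b w) + g d x z (cov_map (\<Gamma> d) (\<lambda>y. y) (\<lambda>y. \<Gamma> d y b w) x a))" for a b
  proof -
    have "deriv_at (\<lambda>y. g d y z w) y b = g d y (\<Gamma> d y b z) w + g d y z (\<Gamma> d y b w)"
      if "y \<in> cimg d" for y
      using g_parallel[OF that] .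
    then have "deriv_at (\<lambda>y. deriv_at (\<lambda>y. g d y z w) y b) x =
        deriv_at (\<lambda>y. g d y (\<Gamma> d y b z) w + g d y z (\<Gamma> d y b w)) x"
      by (rule deriv_at_cong_open[OF open_cimg x])
    also have "\<dots> = (\<lambda>a. (g d x (cov_map (\<Gamma> d) (\<lambda>y. y) (\<lambda>y. \<Gamma> d y b z) x a) w
          + g d x (\<Gamma> d x b z) (\<Gamma> d x a w)) +
        (g d x (\<Gamma> d x a z) (\<Gamma> d x b w) + g d x z (cov_map (\<Gamma> d) (\<lambda>y. y) (\<lambda>y. \<Gamma> d y b w) x a)))"
      using x has_derivative_add[OF along[OF x _ smooth_on_has_derivative[OF smooth_\<Gamma> x, of b z] const[of w]]
          along[OF x _ const[of z] smooth_on_has_derivative[OF smooth_\<Gamma> x, of b w]]]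
      by (intro deriv_at_eq) (simp add: cov_const)
    finally show ?thesis
      by simp
  qed
  from this[of b a] this[of a b] deriv_at_commute[OF open_cimg x smooth_g, of z w b a]
  show ?thesis
    using sym_g[OF x, of z "curvature \<Gamma> d x a b w"]
    by (simp add: cov_map_def id'(2) curvature_def g_simps[OF x] sym_g[OF x, of z])
qed

lemma curvature_space_form:
  assumes x: "x \<in> cimg d" and ex: "area_sq (g d x) u' v' \<noteq> 0"
  obtains \<kappa> where "\<And>u v w z. g d x (curvature \<Gamma> d x u v w) z =
      \<kappa> * (g d x v w * g d x u z - g d x u w * g d x v z)"
proof -
  obtain \<kappa> where \<kappa>: "\<And>u v. area_sq (g d x) u v \<noteq> 0 \<Longrightarrow> sectional_curvature g \<Gamma> d x u v = \<kappa>"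
  proof -
    have "constant_curvature \<A> g \<Gamma>"
      using space_form by (simp add: space_form_def)
    then show ?thesis
      using chart x that unfolding constant_curvature_def by metis
  qed
  define Q where "Q u v w z = g d x (curvature \<Gamma> d x u v w) z -
      \<kappa> * (g d x v w * g d x u z - g d x u w * g d x v z)" for u v w z
  note R = linear_curvature[OF x]
  have lin: "linear (\<lambda>u. Q u v w z)" "linear (\<lambda>v. Q u v w z)" "linear (\<lambda>w. Q u v w z)" "linear (\<lambda>z. Q u v w z)"
    for u v w z
  proof -
    show "linear (\<lambda>u. Q u v w z)"
      by (rule linearI) (simp_all add: Q_def R(1)[THEN linear_add] R(1)[THEN linear_scale]
         g_simps(1,3)[OF x] right_diff_distrib distrib_left distrib_right)
    show "linear (\<lambda>v. Q u v w z)"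
      by (rule linearI) (simp_all add: Q_def R(2)[THEN linear_add] R(2)[THEN linear_scale]
         g_simps(1,3)[OF x] right_diff_distrib distrib_left distrib_right)
    show "linear (\<lambda>w. Q u v w z)"
      by (rule linearI) (simp_all add: Q_def R(3)[THEN linear_add] R(3)[THEN linear_scale]
         g_simps(1-4)[OF x] right_diff_distrib distrib_left distrib_right)
    show "linear (\<lambda>z. Q u v w z)"
      by (rule linearI) (simp_all add: Q_def 
         g_simps(2,4)[OF x] right_diff_distrib distrib_left distrib_right)
  qed
  have "Q u v v u = 0" if "area_sq (g d x) u v \<noteq> 0" for u v
  proof -
    have "g d x (curvature \<Gamma> d x u v v) u = \<kappa> * area_sq (g d x) u v"
      using \<kappa>[OF that] that by (simp add: sectional_curvature_def divide_eq_eq)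
    then show ?thesis
      using sym_g[OF x, of v u] by (simp add: Q_def area_sq_def power2_eq_square mult.commute)
  qed
  note sec = area_sq_eq_0_removable[OF lin bilinear_g[OF x] ex this]
  have "Q u v w z = 0" for u v w z
  proof (rule curvature_tensor_eq_0[OF lin _ _ _ sec])
    fix u v w z
    show "Q u v w z = - Q v u w z"
      unfolding Q_def curvature_anti12[of x u v] g_simps[OF x] by (simp add: algebra_simps)
    show "Q u v w z = - Q u v z w"
      unfolding Q_def curvature_anti34[OF x, of u v w z] by (simp add: algebra_simps)
    have "g d x (curvature \<Gamma> d x u v w) z + g d x (curvature \<Gamma> d x v w u) z + g d x (curvature \<Gamma> d x w u v) z = 0"
      unfolding g_simps(1)[OF x, symmetric] curvature_bianchi[OF x] by (rule g_simps(5)[OF x])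
    then show "Q u v w z + Q v w u z + Q w u v z = 0"
      unfolding Q_def sym_g[OF x, of v u] sym_g[OF x, of w v] sym_g[OF x, of w u] by (simp add: algebra_simps)
  qed
  then have "g d x (curvature \<Gamma> d x u v w) z = \<kappa> * (g d x v w * g d x u z - g d x u w * g d x v z)" for u v w z
    unfolding Q_def by (metis eq_iff_diff_eq_0)
  then show ?thesis
    by (rule that)
qed

end

section \<open>The unit normal of a hypersurface\<close>

lemma chart_coord_cpt:
  assumes "is_chart c"
  shows "p \<in> cdom c \<Longrightarrow> cpt c (coord c p) = p" "x \<in> cimg c \<Longrightarrow> coord c (cpt c x) = x"
    "x \<in> cimg c \<Longrightarrow> cpt c x \<in> cdom c"
  using assms unfolding is_chart_def by (auto simp: homeomorphism_def)

lemma open_coord_image: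
  assumes "is_chart c" "open U" "U \<subseteq> cdom c"
  shows "open (coord c ` U)"
proof -
  have "homeomorphism (cdom c) (cimg c) (coord c) (cpt c)" "open (cdom c)" "open (cimg c)"
    using assms(1) by (auto simp: is_chart_def)
  moreover have "openin (top_of_set (cdom c)) U"
    using assms(2,3) \<open>open (cdom c)\<close> by (simp add: openin_open_eq)
  ultimately show ?thesis
    by (meson homeomorphism_imp_open_map openin_open_trans)
qed

lemma open_ldom:
  assumes "immersion \<B> \<A> F" "smooth_atlas \<B>" "smooth_atlas \<A>" "c \<in> \<B>" "d \<in> \<A>"
  shows "open (ldom F c d)"
proof -
  have c: "is_chart c" and d: "is_chart d"
    using assms by (auto simp: smooth_atlas_def)
  have "continuous_on (cdom c) F"
    using assms(1,4) unfolding immersion_def manifold_carrier_def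
    by (meson UN_upper continuous_on_subset)
  then have "open (cdom c \<inter> F -` cdom d)"
    using c d by (auto simp: is_chart_def intro!: continuous_open_preimage)
  then show ?thesis
    unfolding ldom_def using open_coord_image[OF c] by blast
qed

lemma ldom_cover:
  assumes "immersion \<B> \<A> F" "smooth_atlas \<B>" "c \<in> \<B>" "x \<in> cimg c"
  obtains d where "d \<in> \<A>" "x \<in> ldom F c d"
proof -
  have c: "is_chart c"
    using assms by (auto simp: smooth_atlas_def)
  have p: "cpt c x \<in> cdom c" "coord c (cpt c x) = x"
    using chart_coord_cpt[OF c] assms(4) by auto
  then have "F (cpt c x) \<in> manifold_carrier \<A>"
    using assms(1,3) unfolding immersion_def manifold_carrier_def by blast
  then obtain d where "d \<in> \<A>" "F (cpt c x) \<in> cdom d"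
    by (auto simp: manifold_carrier_def)
  then show ?thesis
    using that p by (force simp: ldom_def)
qed

lemma ldom_subset: "ldom F c d \<subseteq> cimg c"
  by (auto simp: ldom_def cimg_def)

lemma loc_image_subset: "is_chart c \<Longrightarrow> loc F c d ` ldom F c d \<subseteq> cimg d"
  by (auto simp: ldom_def loc_def cimg_def chart_coord_cpt(1))

locale hypersurface_chart = space_form_chart \<A> g \<Gamma> d
  for \<A> :: "('a::{t2_space,second_countable_topology}, 'n::finite option) chart set"
    and g :: "('a, 'n option) two_tensor" and \<Gamma> :: "('a, 'n option) connection"
    and d :: "('a, 'n option) chart" +
  fixes \<B> :: "('s::{t2_space,second_countable_topology}, 'n) chart set"
    and F :: "'s \<Rightarrow> 'a" and N E :: "('s, 'a, 'n option) along"
    and \<gamma> :: "('s, 'n) connection" and h :: "('s, 'n) two_tensor" and A :: "('s, 'n) endomorphism"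
    and \<tau> :: "('s, 'n) one_form" and c :: "('s, 'n) chart"
  assumes hypersurface: "hypersurface \<B> \<A> g F N" and normal: "unit_normal \<B> \<A> g F N E"
    and induced: "induced_data \<B> \<A> \<Gamma> F E \<gamma> h A \<tau>" and chartB: "c \<in> \<B>"
begin

abbreviation "\<Omega> \<equiv> ldom F c d"
abbreviation "L \<equiv> loc F c d"
abbreviation "dL \<equiv> deriv_at L"
abbreviation "e \<equiv> \<lambda>x. E d (cpt c x)"
abbreviation "G x u v \<equiv> g d (L x) (dL x u) (dL x v)"
abbreviation "cov \<equiv> cov_map (\<Gamma> d) L"

lemma atlasB: "smooth_atlas \<B>" and immersion: "immersion \<B> \<A> F"
  using hypersurface by (auto simp: hypersurface_def)

lemma is_chart_c: "is_chart c"
  using atlasB chartB by (auto simp: smooth_atlas_def)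

lemma open_\<Omega>: "open \<Omega>"
  using open_ldom[OF immersion atlasB _ chartB chart] space_form by (simp add: space_form_def)

lemma L_image: "L ` \<Omega> \<subseteq> cimg d" and L_in: "x \<in> \<Omega> \<Longrightarrow> L x \<in> cimg d"
  using loc_image_subset[OF is_chart_c] by auto

lemma \<Omega>_cimg: "x \<in> \<Omega> \<Longrightarrow> x \<in> cimg c"
  using ldom_subset by auto

lemma smooth_L: "smooth_on \<Omega> L" and inj_dL: "x \<in> \<Omega> \<Longrightarrow> inj (dL x)"
  using immersion chart chartB by (auto simp: immersion_def)

lemma linear_dL: "x \<in> \<Omega> \<Longrightarrow> linear (dL x)"
  using has_derivative_linear[OF smooth_on_has_derivative[OF smooth_L]] by simp

lemma dL_eq_0: "x \<in> \<Omega> \<Longrightarrow> dL x u = 0 \<longleftrightarrow> u = 0"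
  using inj_dL linear_dL by (metis linear_0 injD)

lemmas dL_simps = linear_dL[THEN linear_add] linear_dL[THEN linear_diff]
  linear_dL[THEN linear_scale] linear_dL[THEN linear_neg]

lemma smooth_e: "smooth_on \<Omega> e"
  using normal chart chartB by (auto simp: unit_normal_def field_along_def)

lemma normal_e: "x \<in> \<Omega> \<Longrightarrow> g d (L x) (e x) (dL x u) = 0"
    "x \<in> \<Omega> \<Longrightarrow> g d (L x) (dL x u) (e x) = 0"
  and unit_e: "x \<in> \<Omega> \<Longrightarrow> \<bar>g d (L x) (e x) (e x)\<bar> = 1"
  using normal chart chartB sym_g[OF L_in] by (auto simp: unit_normal_def)

lemma unit_e_sq: "x \<in> \<Omega> \<Longrightarrow> g d (L x) (e x) (e x) * g d (L x) (e x) (e x) = 1"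
  using unit_e by (metis abs_mult_self_eq mult_1)

lemma unit_e_nonzero: "x \<in> \<Omega> \<Longrightarrow> g d (L x) (e x) (e x) \<noteq> 0"
  using unit_e by fastforce

lemma bilinear_G: "x \<in> \<Omega> \<Longrightarrow> bilinear (G x)"
  unfolding bilinear_def by (auto intro!: linearI simp: dL_simps g_simps L_in)

lemma sym_G: "x \<in> \<Omega> \<Longrightarrow> G x u v = G x v u"
  by (simp add: sym_g L_in)

lemma nondegenerate_G: "x \<in> \<Omega> \<Longrightarrow> nondegenerate (G x)"
  using hypersurface chart chartB by (auto simp: hypersurface_def)

lemma gauss_formula:
  assumes "x \<in> \<Omega>" "smooth_on \<Omega> Y"
  shows "cov (\<lambda>y. dL y (Y y)) x u = dL x (deriv_at Y x u + \<gamma> c x u (Y x)) + h c x u (Y x) *\<^sub>R e x"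
  using induced assms chart chartB by (simp add: induced_data_def cov_along_def cov_map_def)

lemma gauss_const:
  assumes "x \<in> \<Omega>"
  shows "cov (\<lambda>y. dL y v) x u = dL x (\<gamma> c x u v) + h c x u v *\<^sub>R e x"
  using gauss_formula[OF assms smooth_on_const, of v u] by simp

lemma weingarten_formula:
  assumes "x \<in> \<Omega>"
  shows "cov e x u = - dL x (A c x u) + \<tau> c x u *\<^sub>R e x"
  using induced assms chart chartB by (simp add: induced_data_def cov_along_def cov_map_def)

lemma bilinear_\<gamma>: "x \<in> cimg c \<Longrightarrow> bilinear (\<gamma> c x)"
  and linear_A: "x \<in> cimg c \<Longrightarrow> linear (A c x)" and smooth_A: "smooth_on (cimg c) (\<lambda>x. A c x u)"
  and smooth_h: "smooth_on (cimg c) (\<lambda>x. h c x u v)"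
  and sym_h: "x \<in> cimg c \<Longrightarrow> h c x u v = h c x v u"
  using induced chartB
  by (auto simp: induced_data_def affine_connection_def endomorphism_field_def two_tensor_field_def
      symmetric_tensor_def)

lemma A_derivative: "x \<in> \<Omega> \<Longrightarrow>
    ((\<lambda>y. A c y u) has_derivative deriv_at (\<lambda>y. A c y u) x) (at x)"
  by (rule smooth_on_has_derivative[OF smooth_A \<Omega>_cimg])

lemma dL_derivative: "x \<in> \<Omega> \<Longrightarrow>
    ((\<lambda>y. dL y u) has_derivative deriv_at (\<lambda>y. dL y u) x) (at x)"
  by (rule smooth_on_has_derivative[OF smooth_on_deriv_at[OF smooth_L]])

lemma metric_along:
  assumes x: "x \<in> \<Omega>"
    and V: "(V has_derivative deriv_at V x) (at x)" and W: "(W has_derivative deriv_at W x) (at x)"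
  shows "((\<lambda>y. g d (L y) (V y) (W y)) has_derivative
     (\<lambda>u. g d (L x) (cov V x u) (W x) + g d (L x) (V x) (cov W x u))) (at x)"
  by (rule has_derivative_metric_along[OF open_\<Omega> x L_image smooth_on_has_derivative[OF smooth_L x] V W])

lemma unit_e_derivative:
  assumes x: "x \<in> \<Omega>"
  shows "((\<lambda>y. g d (L y) (e y) (e y)) has_derivative (\<lambda>_. 0)) (at x)"
proof -
  let ?q = "\<lambda>y. g d (L y) (e y) (e y)"
  note e = smooth_on_has_derivative[OF smooth_e x]
  define q' where "q' = (\<lambda>u. g d (L x) (cov e x u) (e x) + g d (L x) (e x) (cov e x u))"
  have q': "(?q has_derivative q') (at x)"
    unfolding q'_def by (rule metric_along[OF x e e])
  have "((\<lambda>y. ?q y * ?q y) has_derivative (\<lambda>_. 0)) (at x)"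
    by (rule has_derivative_transform_within_open[OF has_derivative_const[of 1] open_\<Omega> x])
      (simp add: unit_e_sq)
  with has_derivative_mult[OF q' q'] have "(\<lambda>u. ?q x * q' u + q' u * ?q x) = (\<lambda>_. 0)"
    by (rule has_derivative_unique)
  then have "?q x * q' u + q' u * ?q x = 0" for u
    by meson
  then have "q' = (\<lambda>_. 0)"
    using unit_e_nonzero[OF x] by (auto simp: fun_eq_iff)
  with q' show ?thesis
    by simp
qed

lemma \<tau>_eq_0:
  assumes x: "x \<in> \<Omega>"
  shows "\<tau> c x u = 0"
proof -
  note e = smooth_on_has_derivative[OF smooth_e x]
  have "g d (L x) (cov e x u) (e x) + g d (L x) (e x) (cov e x u) = 0"
    using has_derivative_unique[OF metric_along[OF x e e] unit_e_derivative[OF x]] by meson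
  then show ?thesis
    using x unit_e_nonzero[OF x] by (simp add: weingarten_formula g_simps[OF L_in[OF x]] normal_e)
qed

lemma cov_e: "x \<in> \<Omega> \<Longrightarrow> cov e x u = - dL x (A c x u)"
  by (simp add: weingarten_formula \<tau>_eq_0)

lemma second_fundamental_form:
  assumes x: "x \<in> \<Omega>"
  shows "h c x u v = g d (L x) (e x) (e x) * G x (A c x u) v"
proof -
  have zero: "((\<lambda>y. g d (L y) (e y) (dL y v)) has_derivative (\<lambda>_. 0)) (at x)"
    by (rule has_derivative_transform_within_open[OF has_derivative_const[of 0] open_\<Omega> x])
      (simp add: normal_e)
  have "g d (L x) (cov e x u) (dL x v) + g d (L x) (e x) (cov (\<lambda>y. dL y v) x u) = 0"
    using has_derivative_unique[OF metric_along[OF x smooth_on_has_derivative[OF smooth_e x]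
          dL_derivative[OF x, of v]] zero] by meson
  then have "G x (A c x u) v = h c x u v * g d (L x) (e x) (e x)"
    by (simp add: cov_e[OF x] gauss_const[OF x] g_simps[OF L_in[OF x]] normal_e[OF x])
  then have "g d (L x) (e x) (e x) * G x (A c x u) v =
      h c x u v * (g d (L x) (e x) (e x) * g d (L x) (e x) (e x))"
    by simp
  then show ?thesis
    by (simp add: unit_e_sq[OF x])
qed

lemma G_derivative:
  assumes x: "x \<in> \<Omega>"
  shows "((\<lambda>y. G y u v) has_derivative (\<lambda>w. G x (\<gamma> c x w u) v + G x u (\<gamma> c x w v))) (at x)"
  using metric_along[OF x dL_derivative[OF x, of u] dL_derivative[OF x, of v]]
  by (simp add: gauss_const[OF x] g_simps[OF L_in[OF x]] normal_e[OF x])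

text \<open>The vector \<open>(\<nabla>\<^sub>w A) u\<close>.\<close>

definition cov_A :: "real^'n \<Rightarrow> real^'n \<Rightarrow> real^'n \<Rightarrow> real^'n" where
  "cov_A x w u = deriv_at (\<lambda>y. A c y u) x w + \<gamma> c x w (A c x u) - A c x (\<gamma> c x w u)"

lemma cov_deriv_h:
  assumes x: "x \<in> \<Omega>"
  shows "cov_deriv_tensor \<gamma> h c x w u v = g d (L x) (e x) (e x) * G x (cov_A x w u) v"
proof -
  let ?q = "\<lambda>y. g d (L y) (e y) (e y)"
  have const: "((\<lambda>_. v) has_derivative (\<lambda>_. 0)) (at x)"
    by (rule has_derivative_const)
  have "((\<lambda>y. G y (A c y u) v) has_derivative (\<lambda>w. G x (\<gamma> c x w (A c x u)) v + G x (A c x u) (\<gamma> c x w v)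
      + G x (deriv_at (\<lambda>y. A c y u) x w) v + G x (A c x u) 0)) (at x)"
    by (rule has_derivative_bilinear_field[OF open_\<Omega> x bilinear_G G_derivative[OF x] A_derivative[OF x] const])
  from has_derivative_mult[OF unit_e_derivative[OF x] this]
  have "((\<lambda>y. h c y u v) has_derivative (\<lambda>w. ?q x * (G x (\<gamma> c x w (A c x u)) v + G x (A c x u) (\<gamma> c x w v)
      + G x (deriv_at (\<lambda>y. A c y u) x w) v + G x (A c x u) 0) + 0 * G x (A c x u) v)) (at x)"
    by (rule has_derivative_transform_within_open[OF _ open_\<Omega> x]) (simp add: second_fundamental_form)
  from deriv_at_eq[OF this] show ?thesis
    by (simp add: cov_deriv_tensor_def cov_A_def second_fundamental_form[OF x]
        bilinear_ladd[OF bilinear_G[OF x]] bilinear_lsub[OF bilinear_G[OF x]]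
        bilinear_rzero[OF bilinear_G[OF x]] algebra_simps)
qed

lemma exists_nonzero_area:
  assumes x: "x \<in> \<Omega>"
  obtains u v where "area_sq (g d (L x)) u v \<noteq> 0"
proof -
  obtain i :: 'n where True by simp
  have "\<exists>u. G x u u \<noteq> 0"
  proof (rule ccontr)
    assume "\<nexists>u. G x u u \<noteq> 0"
    then have zero: "G x u u = 0" for u
      by simp
    have "G x u v = 0" for u v
    proof -
      have "G x (u + v) (u + v) = G x u u + G x u v + (G x v u + G x v v)"
        by (simp only: bilinear_ladd[OF bilinear_G[OF x]] bilinear_radd[OF bilinear_G[OF x]])
      then show ?thesis
        unfolding zero using sym_G[OF x, of u v] by simp
    qed
    then have "axis i (1::real) = 0"
      using nondegenerate_G[OF x] unfolding nondegenerate_def by blast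
    then show False
      by (simp add: axis_eq_0_iff)
  qed
  then obtain u where "G x u u \<noteq> 0"
    by blast
  then have "area_sq (g d (L x)) (e x) (dL x u) \<noteq> 0"
    using unit_e_nonzero[OF x] normal_e[OF x] by (simp add: area_sq_def)
  then show ?thesis
    by (rule that)
qed

lemma codazzi:
  assumes x: "x \<in> \<Omega>" and sym: "\<And>u v. \<gamma> c x u v = \<gamma> c x v u"
  shows "cov_A x w u = cov_A x u w"
proof -
  have cov2: "cov (\<lambda>y. cov e y u) x w =
      - (dL x (deriv_at (\<lambda>y. A c y u) x w + \<gamma> c x w (A c x u)) + h c x w (A c x u) *\<^sub>R e x)" for u w
  proof -
    let ?V = "\<lambda>y. dL y (A c y u)"
    have D: "((\<lambda>y. cov e y u) has_derivative deriv_at (\<lambda>y. cov e y u) x) (at x)"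
      using has_derivative_cov_map[OF open_\<Omega> x L_image smooth_L smooth_e, of u]
      unfolding deriv_at_eq[OF has_derivative_cov_map[OF open_\<Omega> x L_image smooth_L smooth_e, of u]] .
    have "(?V has_derivative (\<lambda>w. - deriv_at (\<lambda>y. cov e y u) x w)) (at x)"
      by (rule has_derivative_transform_within_open[OF has_derivative_minus[OF D] open_\<Omega> x]) (simp add: cov_e)
    then have "deriv_at ?V x w = - deriv_at (\<lambda>y. cov e y u) x w"
      by (simp add: deriv_at_eq)
    then have "cov (\<lambda>y. cov e y u) x w = - cov ?V x w"
      unfolding cov_map_def[of _ _ ?V] cov_map_def[of _ _ "\<lambda>y. cov e y u"]
      by (simp add: cov_e[OF x] bilinear_rneg[OF bilinear_\<Gamma>[OF L_in[OF x]]])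
    also have "cov ?V x w = dL x (deriv_at (\<lambda>y. A c y u) x w + \<gamma> c x w (A c x u)) + h c x w (A c x u) *\<^sub>R e x"
      by (rule gauss_formula[OF x smooth_on_subset[OF smooth_A ldom_subset]])
    finally show ?thesis .
  qed
  obtain u' v' where "area_sq (g d (L x)) u' v' \<noteq> 0"
    using exists_nonzero_area[OF x] .
  then obtain \<kappa> where \<kappa>: "\<And>u v w z. g d (L x) (curvature \<Gamma> d (L x) u v w) z =
      \<kappa> * (g d (L x) v w * g d (L x) u z - g d (L x) u w * g d (L x) v z)"
    using curvature_space_form[OF L_in[OF x]] by blast
  have "G x (cov_A x w u - cov_A x u w) v = 0" for v
  proof -
    have "g d (L x) (cov (\<lambda>y. cov e y u) x w - cov (\<lambda>y. cov e y w) x u) (dL x v) = 0"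
      unfolding ricci_identity[OF open_\<Omega> x L_image smooth_L smooth_e] \<kappa> normal_e[OF x] by simp
    then show ?thesis
      unfolding cov2 cov_A_def sym[of w u]
      by (simp add: g_simps[OF L_in[OF x]] normal_e[OF x] dL_simps[OF x])
  qed
  then show ?thesis
    using nondegenerate_G[OF x] unfolding nondegenerate_def by (metis eq_iff_diff_eq_0)
qed

end

section \<open>The equiaffine normal\<close>

context hypersurface_chart
begin

lemma trace_cov_A:
  assumes x: "x \<in> \<Omega>" and det: "\<And>y. y \<in> \<Omega> \<Longrightarrow> det (matrix (A c y)) = \<delta>" and "\<delta> \<noteq> 0"
  obtains C where "trace (matrix C) = 0" "\<And>p. A c x (C (axis p 1)) = cov_A x w (axis p 1)"
proof -
  define M where "M y = matrix (A c y)" for y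
  define B where "B v = (\<chi> i j. deriv_at (\<lambda>y. A c y (axis j 1)) x v $ i)" for v
  define P where "P = matrix (\<gamma> c x w)"
  have "invertible (M x)"
    using det[OF x] \<open>\<delta> \<noteq> 0\<close> by (simp add: M_def invertible_det_nz)
  then obtain J where J: "M x ** J = mat 1" "J ** M x = mat 1"
    by (auto simp: invertible_def)
  have comp: "((\<lambda>y. M y $ i $ j) has_derivative (\<lambda>v. B v $ i $ j)) (at x)" for i j
    unfolding M_def B_def matrix_def
    using bounded_linear.has_derivative[OF bounded_linear_vec_nth A_derivative[OF x, of "axis j 1"]]
    by simp
  have "((\<lambda>y. (J ** M y) $ i $ j) has_derivative (\<lambda>v. (J ** B v) $ i $ j)) (at x)" for i j
    unfolding matrix_matrix_mult_def vec_lambda_beta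
    by (intro has_derivative_sum has_derivative_mult_right comp)
  then have 1: "((\<lambda>y. det (J ** M y)) has_derivative (\<lambda>v. trace (J ** B v))) (at x)"
    by (rule has_derivative_det_at_one) (rule J)
  have "((\<lambda>y. det (J ** M y)) has_derivative (\<lambda>_. 0)) (at x)"
    by (rule has_derivative_transform_within_open[OF has_derivative_const[of "det J * \<delta>"] open_\<Omega> x])
      (simp add: det_mul M_def det)
  from has_derivative_unique[OF 1 this] have tr: "trace (J ** B w) = 0"
    by meson
  define C where "C = J ** (B w + P ** M x) - P"
  have "trace (J ** (P ** M x)) = trace P"
    by (subst trace_mul_sym) (simp add: matrix_mul_assoc[symmetric] J)
  then have "trace C = 0"
    by (simp add: C_def trace_sub trace_add matrix_add_ldistrib tr)
  moreover have "A c x (C *v axis p 1) = cov_A x w (axis p 1)" for p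
  proof -
    have A: "A c x u = M x *v u" for u
      using linear_A[OF \<Omega>_cimg[OF x]] by (simp add: M_def)
    have "linear (\<gamma> c x w)"
      using bilinear_\<gamma>[OF \<Omega>_cimg[OF x]] by (simp add: bilinear_def)
    then have P: "\<gamma> c x w u = P *v u" for u
      by (simp add: P_def)
    have B: "B w *v axis p 1 = deriv_at (\<lambda>y. A c y (axis p 1)) x w"
      by (simp add: matrix_vector_mult_basis column_def B_def)
    have "M x *v (C *v u) = (M x ** J) *v (B w *v u + P *v (M x *v u)) - M x *v (P *v u)" for u
      by (simp add: C_def matrix_vector_mult_diff_rdistrib matrix_vector_mult_add_rdistrib
          matrix_vector_mult_diff_distrib matrix_vector_mul_assoc[symmetric])
    then show ?thesis
      by (simp add: cov_A_def A P B J)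
  qed
  ultimately show ?thesis
    using that[of "\<lambda>u. C *v u"] by simp
qed

lemma abs_vol_normal:
  assumes x: "x \<in> \<Omega>"
  shows "abs_vol (g d (L x)) (case_option (e x) (\<lambda>i. dL x (axis i 1))) = sqrt \<bar>det (gram (G x))\<bar>"
proof -
  let ?v = "case_option (e x) (\<lambda>i. dL x (axis i 1))"
  have "det (\<chi> i j. g d (L x) (?v i) (?v j)) = g d (L x) (e x) (e x) * det (gram (G x))"
    by (subst det_option_block) (simp_all add: normal_e[OF x] gram_def)
  then show ?thesis
    using unit_e[OF x] by (simp add: abs_vol_conv_gram[OF bilinear_g[OF L_in[OF x]]] abs_mult)
qed

end

locale equiaffine_chart = hypersurface_chart \<A> g \<Gamma> d \<B> F N E \<gamma> h A \<tau> c
  for \<A> :: "('a::{t2_space,second_countable_topology}, 'n::finite option) chart set"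
    and g \<Gamma> d and \<B> :: "('s::{t2_space,second_countable_topology}, 'n) chart set" and F N E \<gamma> h A \<tau> c +
  fixes W :: "('s, 'a, 'n option) along" and \<gamma>' :: "('s, 'n) connection" and k :: "('s, 'n) two_tensor"
    and S' :: "('s, 'n) endomorphism" and \<tau>' :: "('s, 'n) one_form" and \<delta> :: real
  assumes dim: "CARD('n) \<ge> 2" and co_oriented: "co_oriented \<B> \<A> F N W"
    and induced_W: "induced_data \<B> \<A> \<Gamma> F W \<gamma>' k S' \<tau>'" and aligned: "aligned \<B> \<gamma>' k"
    and volume: "volume_normalized \<B> \<A> g F W k"
    and det_A: "x \<in> \<Omega> \<Longrightarrow> det (matrix (A c x)) = \<delta>" and \<delta>_nonzero: "\<delta> \<noteq> 0"
begin

abbreviation "w \<equiv> \<lambda>x. W d (cpt c x)"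

lemma w_decomposition:
  assumes x: "x \<in> \<Omega>"
  obtains f U where "f > 0" "w x = f *\<^sub>R e x + dL x U"
proof -
  obtain a u where a: "a > 0" "e x = a *\<^sub>R N d (cpt c x) + dL x u"
    using normal x chart chartB unfolding unit_normal_def co_oriented_def by blast
  obtain b v where b: "b > 0" "w x = b *\<^sub>R N d (cpt c x) + dL x v"
    using co_oriented x chart chartB unfolding co_oriented_def by blast
  have "w x = (b / a) *\<^sub>R e x + dL x (v - (b / a) *\<^sub>R u)"
    using a by (simp add: b(2) dL_simps[OF x] scaleR_add_right)
  moreover have "b / a > 0"
    using a b by simp
  ultimately show ?thesis
    using that by blast
qed

lemma bilinear_k: "x \<in> cimg c \<Longrightarrow> bilinear (k c x)" and sym_k: "x \<in> cimg c \<Longrightarrow> k c x u v = k c x v u"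
  using induced_W chartB by (auto simp: induced_data_def two_tensor_field_def symmetric_tensor_def)

lemma gauss_W:
  assumes "x \<in> \<Omega>"
  shows "cov (\<lambda>y. dL y v) x u = dL x (\<gamma>' c x u v) + k c x u v *\<^sub>R w x"
proof -
  have "\<forall>Y. smooth_on \<Omega> Y \<longrightarrow> cov (\<lambda>y. dL y (Y y)) x u =
      dL x (deriv_at Y x u + \<gamma>' c x u (Y x)) + k c x u (Y x) *\<^sub>R w x"
    using induced_W assms chart chartB by (simp add: induced_data_def cov_along_def cov_map_def)
  from this[rule_format, OF smooth_on_const, of v] show ?thesis
    by simp
qed

lemma induced_relations:
  assumes x: "x \<in> \<Omega>" and w: "w x = f *\<^sub>R e x + dL x U"
  shows "h c x u v = f * k c x u v" "\<gamma>' c x u v = \<gamma> c x u v - k c x u v *\<^sub>R U"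
proof -
  have eq: "dL x (\<gamma> c x u v) + h c x u v *\<^sub>R e x =
      dL x (\<gamma>' c x u v) + k c x u v *\<^sub>R (f *\<^sub>R e x + dL x U)"
    using gauss_const[OF x, of v u] gauss_W[OF x, of v u] w by simp
  then have "g d (L x) (dL x (\<gamma> c x u v) + h c x u v *\<^sub>R e x) (e x) =
     g d (L x) (dL x (\<gamma>' c x u v) + k c x u v *\<^sub>R (f *\<^sub>R e x + dL x U)) (e x)"
    by simp
  then show h: "h c x u v = f * k c x u v"
    using unit_e_nonzero[OF x] by (simp add: g_simps[OF L_in[OF x]] normal_e[OF x])
  have "dL x (\<gamma>' c x u v - (\<gamma> c x u v - k c x u v *\<^sub>R U)) = 0"
    using eq unfolding h by (simp add: dL_simps[OF x] algebra_simps)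
  then show "\<gamma>' c x u v = \<gamma> c x u v - k c x u v *\<^sub>R U"
    using dL_eq_0[OF x] by simp
qed

lemma height_power:
  assumes x: "x \<in> \<Omega>" and w: "w x = f *\<^sub>R e x + dL x U" and f: "f > 0"
  shows "f ^ (CARD('n) + 2) = \<bar>\<delta>\<bar>"
proof -
  let ?n = "CARD('n)" and ?q = "g d (L x) (e x) (e x)"
  let ?D = "det (gram (G x))"
  have k: "k c x u v = (?q / f) * G x (A c x u) v" for u v
    using induced_relations(1)[OF x w, of u v] second_fundamental_form[OF x, of u v] f
    by (simp add: field_simps)
  have "gram (k c x) = (\<chi> i. (?q / f) *s (transpose (matrix (A c x)) ** gram (G x)) $ i)"
  proof -
    have "G x (A c x (axis i 1)) (axis j 1) = (transpose (matrix (A c x)) ** gram (G x)) $ i $ j" for i j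
      unfolding bilinear_expand_left[OF bilinear_G[OF x], of "A c x _"]
      by (simp add: matrix_matrix_mult_def transpose_def matrix_def gram_def)
    then show ?thesis
      by (simp add: vec_eq_iff gram_def k)
  qed
  then have "det (gram (k c x)) = (?q / f) ^ ?n * (det (matrix (A c x)) * ?D)"
    by (simp add: det_rows_mul det_mul)
  moreover have "abs_vol (k c x) (\<lambda>i. axis i 1) = sqrt \<bar>det (gram (k c x))\<bar>"
    unfolding abs_vol_conv_gram[OF bilinear_k[OF \<Omega>_cimg[OF x]]] gram_def ..
  moreover have "abs_vol (k c x) (\<lambda>i. axis i 1) = f * sqrt \<bar>?D\<bar>"
  proof -
    have "dL x U \<in> span (range (\<lambda>i. dL x (axis i 1)))"
    proof -
      have "dL x (\<Sum>i\<in>UNIV. U $ i *\<^sub>R axis i 1) \<in> span (range (\<lambda>i. dL x (axis i 1)))"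
        unfolding linear_sum[OF linear_dL[OF x]] linear_scale[OF linear_dL[OF x]]
        by (intro span_sum span_scale span_base) auto
      then show ?thesis
        using basis_expansion[of U] by (simp add: scalar_mult_eq_scaleR)
    qed
    then have "abs_vol (g d (L x)) (case_option (w x) (\<lambda>i. dL x (axis i 1))) = f * sqrt \<bar>?D\<bar>"
      unfolding w using f by (simp add: abs_vol_case_option abs_vol_normal[OF x])
    then show ?thesis
      using volume x chart chartB by (simp add: volume_normalized_def)
  qed
  ultimately have "(f * sqrt \<bar>?D\<bar>)\<^sup>2 = \<bar>(?q / f) ^ ?n * (\<delta> * ?D)\<bar>"
    by (simp add: det_A[OF x])
  then have "f\<^sup>2 * \<bar>?D\<bar> = (1 / f) ^ ?n * (\<bar>\<delta>\<bar> * \<bar>?D\<bar>)"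
    using f unit_e[OF x] by (simp add: power_mult_distrib abs_mult power_abs)
  moreover have "?D \<noteq> 0"
    by (rule det_gram_nonzero[OF bilinear_G[OF x] sym_G[OF x] nondegenerate_G[OF x]])
  ultimately have "f\<^sup>2 = (1 / f) ^ ?n * \<bar>\<delta>\<bar>"
    by simp
  then show ?thesis
    using f by (simp add: power_divide power2_eq_square field_simps)
qed

definition height :: real where
  "height = root (CARD('n) + 2) \<bar>\<delta>\<bar>"

lemma height_pos: "height > 0"
  using \<delta>_nonzero by (simp add: height_def)

lemma w_height:
  assumes x: "x \<in> \<Omega>"
  obtains U where "w x = height *\<^sub>R e x + dL x U"
proof -
  obtain f U where f: "f > 0" "w x = f *\<^sub>R e x + dL x U"
    using w_decomposition[OF x] .
  then have "f = height"
    using height_power[OF x f(2,1)] unfolding height_def by (metis add_2_eq_Suc' less_imp_le real_root_power_cancel zero_less_Suc)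
  then show ?thesis
    using f that by blast
qed

lemma k_eq: "x \<in> \<Omega> \<Longrightarrow> k c x u v = h c x u v / height"
  using induced_relations(1) w_height height_pos by (metis nonzero_mult_div_cancel_left less_irrefl)

lemma nondegenerate_k:
  assumes x: "x \<in> \<Omega>"
  shows "nondegenerate (k c x)"
  unfolding nondegenerate_def
proof (intro allI impI)
  fix u assume "\<forall>v. k c x u v = 0"
  then have "G x (A c x u) v = 0" for v
    using height_pos unit_e_nonzero[OF x] by (simp add: k_eq[OF x] second_fundamental_form[OF x])
  then have "A c x u = 0"
    using nondegenerate_G[OF x] unfolding nondegenerate_def by blast
  moreover have "A c x v = matrix (A c x) *v v" for v
    using linear_A[OF \<Omega>_cimg[OF x]] by simp
  moreover have "invertible (matrix (A c x))"
    using det_A[OF x] \<delta>_nonzero by (simp add: invertible_det_nz)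
  ultimately show "u = 0"
    by (metis invertible_left_inverse matrix_left_invertible_ker)
qed

lemma w_eq:
  assumes x: "x \<in> \<Omega>"
  shows "w x = height *\<^sub>R e x"
proof -
  let ?n = "real CARD('n)"
  note xc = \<Omega>_cimg[OF x]
  obtain U where U: "w x = height *\<^sub>R e x + dL x U"
    using w_height[OF x] .
  note rel = induced_relations[OF x U]
  note k = bilinear_k[OF xc] sym_k[OF xc] nondegenerate_k[OF x]
  have "\<gamma>' c x u v = \<gamma>' c x v u" for u v
    using aligned chartB xc unfolding aligned_def torsion_free_def by blast
  then have torsion: "\<gamma> c x u v = \<gamma> c x v u" for u v
    using rel(2)[of u v] rel(2)[of v u] sym_k[OF xc, of u v] by simp
  define T where "T w u v = cov_deriv_tensor \<gamma> h c x w u v / height" for w u v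
  have T: "T w u v = k c x (C u) v" if "A c x (C u) = cov_A x w u" for w u v C
    using that by (simp add: T_def cov_deriv_h[OF x] k_eq[OF x] second_fundamental_form[OF x])
  have T_sym: "T w u v = T u w v" for w u v
    by (simp add: T_def cov_deriv_h[OF x] codazzi[OF x torsion, of w u])
  have T_sym': "T w u v = T w v u" for w u v
  proof -
    have "deriv_at (\<lambda>y. h c y u v) x w = deriv_at (\<lambda>y. h c y v u) x w"
      using deriv_at_cong_open[OF open_\<Omega> x, of "\<lambda>y. h c y u v" "\<lambda>y. h c y v u"] sym_h[OF \<Omega>_cimg] by simp
    then show ?thesis
      by (simp add: T_def cov_deriv_tensor_def sym_h[OF xc, of "\<gamma> c x w u"] sym_h[OF xc, of u])
  qed
  have cov_k: "cov_deriv_tensor \<gamma>' k c x w u v = T w u v + k c x w u * k c x U v + k c x w v * k c x u U" for w u v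
  proof -
    have "deriv_at (\<lambda>y. k c y u v) x = deriv_at (\<lambda>y. h c y u v / height) x"
      by (rule deriv_at_cong_open[OF open_\<Omega> x]) (rule k_eq)
    also have "\<dots> = (\<lambda>w. deriv_at (\<lambda>y. h c y u v) x w / height)"
      by (intro deriv_at_eq bounded_linear.has_derivative[OF bounded_linear_divide]
          smooth_on_has_derivative[OF smooth_h xc])
    finally show ?thesis
      by (simp add: cov_deriv_tensor_def rel(2) T_def bilinear_lsub[OF k(1)] bilinear_rsub[OF k(1)]
          bilinear_lmul[OF k(1)] bilinear_rmul[OF k(1)])
        (simp add: k_eq[OF x] diff_divide_distrib)
  qed
  define tr where "tr X = (\<Sum>p\<in>UNIV. \<Sum>q\<in>UNIV. matrix_inv (gram (k c x)) $ p $ q * X p q)" for X :: "'n \<Rightarrow> 'n \<Rightarrow> real"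
  have tr_add: "tr (\<lambda>p q. X p q + Y p q) = tr X + tr Y" for X Y
    by (simp add: tr_def distrib_left sum.distrib)
  have tr_mult: "tr (\<lambda>p q. a * X p q) = a * tr X" for a X
    by (simp add: tr_def sum_distrib_left mult_ac)
  have tr_trace: "tr (\<lambda>p q. k c x (C (axis p 1)) (axis q 1)) = trace (matrix C)" for C
    unfolding tr_def by (rule metric_trace[OF k])
  have tr_T: "tr (\<lambda>p q. T w (axis p 1) (axis q 1)) = 0" for w
  proof -
    obtain C where C: "trace (matrix C) = 0" "\<And>p. A c x (C (axis p 1)) = cov_A x w (axis p 1)"
      using trace_cov_A[OF x det_A \<delta>_nonzero, where w = w] by blast
    then show ?thesis
      using tr_trace[of C] by (simp add: T[of C])
  qed
  have tr_k: "tr (\<lambda>p q. k c x (axis p 1) (axis q 1)) = ?n"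
    using tr_trace[of id] by (simp add: matrix_id_mat_1 trace_I)
  have tr_rank1: "tr (\<lambda>p q. k c x (axis p 1) u * k c x v (axis q 1)) = k c x v u" for u v
  proof -
    let ?C = "\<lambda>y. k c x y u *\<^sub>R v"
    from tr_trace[of ?C] have "tr (\<lambda>p q. k c x (axis p 1) u * k c x v (axis q 1)) = trace (matrix ?C)"
      by (simp add: bilinear_lmul[OF k(1)])
    also have "trace (matrix ?C) = (\<Sum>p\<in>UNIV. v $ p * k c x (axis p 1) u)"
      by (simp add: trace_def matrix_def mult.commute)
    also have "\<dots> = k c x v u"
      by (rule bilinear_expand_left[OF k(1), symmetric])
    finally show ?thesis .
  qed
  have "k c x U (axis i 1) = 0" for i
  proof -
    let ?a = "axis i 1 :: real^'n"
    let ?u = "k c x U ?a"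
    have "?n * tr (\<lambda>p q. cov_deriv_tensor \<gamma>' k c x (axis p 1) (axis q 1) ?a) =
        tr (\<lambda>p q. cov_deriv_tensor \<gamma>' k c x ?a (axis p 1) (axis q 1))"
      using aligned chartB xc unfolding aligned_def tr_def by blast
    moreover have "cov_deriv_tensor \<gamma>' k c x (axis p 1) (axis q 1) ?a =
        T ?a (axis p 1) (axis q 1) + ?u * k c x (axis p 1) (axis q 1) +
        k c x (axis p 1) ?a * k c x U (axis q 1)" for p q
      using T_sym[of ?a "axis p 1" "axis q 1"] T_sym'[of "axis p 1" "axis q 1" ?a]
      by (simp add: cov_k sym_k[OF xc, of _ U])
    moreover have "cov_deriv_tensor \<gamma>' k c x ?a (axis p 1) (axis q 1) =
        T ?a (axis p 1) (axis q 1) + k c x (axis p 1) ?a * k c x U (axis q 1)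
        + k c x (axis p 1) U * k c x ?a (axis q 1)" for p q
      by (simp add: cov_k sym_k[OF xc, of ?a "axis p 1"])
    ultimately have "?n * (?u * ?n + ?u) = 2 * ?u"
      using sym_k[OF xc, of ?a U] by (simp add: tr_add tr_mult tr_T tr_k tr_rank1)
    then have "(?n - 1) * (?n + 2) * ?u = 0"
      by (simp add: algebra_simps)
    moreover have "?n - 1 \<noteq> 0" "?n + 2 \<noteq> 0"
      using dim by auto
    ultimately show ?thesis
      by simp
  qed
  then have "k c x U v = 0" for v
    using bilinear_expand_left[OF k(1), of v U] by (simp add: sym_k[OF xc, of _ U])
  then have "U = 0"
    using k(3) unfolding nondegenerate_def by blast
  then show ?thesis
    using U linear_0[OF linear_dL[OF x]] by simp
qed

lemma shape_operator_W:
  assumes x: "x \<in> \<Omega>" and S: "shape_operator \<B> \<A> \<Gamma> F W S"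
  shows "S c x u = height *\<^sub>R A c x u"
proof -
  obtain \<gamma>'' h'' \<tau>'' where "induced_data \<B> \<A> \<Gamma> F W \<gamma>'' h'' S \<tau>''"
    using S by (auto simp: shape_operator_def)
  then have "cov w x u = - dL x (S c x u) + \<tau>'' c x u *\<^sub>R w x"
    using x chart chartB by (simp add: induced_data_def cov_along_def cov_map_def)
  moreover have "cov w x u = height *\<^sub>R cov e x u"
  proof -
    have "deriv_at w x = deriv_at (\<lambda>y. height *\<^sub>R e y) x"
      by (rule deriv_at_cong_open[OF open_\<Omega> x]) (rule w_eq)
    also have "\<dots> = (\<lambda>u. height *\<^sub>R deriv_at e x u)"
      by (intro deriv_at_eq has_derivative_scaleR_right smooth_on_has_derivative[OF smooth_e x])
    finally show ?thesis
      by (simp add: cov_map_def w_eq[OF x] bilinear_rmul[OF bilinear_\<Gamma>[OF L_in[OF x]]] scaleR_add_right)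
  qed
  ultimately have eq: "dL x (S c x u - height *\<^sub>R A c x u) = (\<tau>'' c x u * height) *\<^sub>R e x"
    by (simp add: cov_e[OF x] w_eq[OF x] dL_simps[OF x] algebra_simps)
  then have "g d (L x) ((\<tau>'' c x u * height) *\<^sub>R e x) (e x) = 0"
    using normal_e(2)[OF x] by metis
  then have "\<tau>'' c x u * height = 0"
    using unit_e_nonzero[OF x] by (simp add: g_simps[OF L_in[OF x]])
  with eq show ?thesis
    by (simp add: dL_eq_0[OF x])
qed

lemma mean_curvature_W:
  assumes x: "x \<in> \<Omega>" and S: "shape_operator \<B> \<A> \<Gamma> F W S"
  shows "mean_curvature S c x = root (CARD('n) + 2) \<bar>\<delta>\<bar> * trace (matrix (A c x)) / CARD('n)"
  by (simp add: mean_curvature_def trace_def matrix_def shape_operator_W[OF assms] sum_distrib_left height_def)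

end

theorem corollary4p3:
  fixes \<A> :: "('a::{t2_space,second_countable_topology}, 'n::finite option) chart set"
    and g :: "('a, 'n option) two_tensor"
    and \<Gamma> :: "('a, 'n option) connection"
    and \<B> :: "('s::{t2_space,second_countable_topology}, 'n) chart set"
    and F :: "'s \<Rightarrow> 'a"
    and N E W :: "('s, 'a, 'n option) along"
    and A S :: "('s, 'n) endomorphism"
  assumes dim: "CARD('n) \<ge> 2"
    and ambient: "space_form \<A> g \<Gamma>"
    and hypersurface: "hypersurface \<B> \<A> g F N"
    and normal: "unit_normal \<B> \<A> g F N E"
    and shape: "shape_operator \<B> \<A> \<Gamma> F E A"
    and isoparametric: "isoparametric \<B> A"
    and gauss_kronecker: "\<And>c x. c \<in> \<B> \<Longrightarrow> x \<in> cimg c \<Longrightarrow> gauss_kronecker A c x \<noteq> 0"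
    and equiaffine: "equiaffine_normal \<B> \<A> g \<Gamma> F N W"
    and equiaffine_shape: "shape_operator \<B> \<A> \<Gamma> F W S"
  shows "\<exists>H. \<forall>c\<in>\<B>. \<forall>x\<in>cimg c. mean_curvature S c x = H"
proof (cases "\<exists>c0\<in>\<B>. \<exists>x0. x0 \<in> cimg c0")
  case False
  then show ?thesis
    by blast
next
  case True
  then obtain c0 x0 where base: "c0 \<in> \<B>" "x0 \<in> cimg c0"
    by blast
  define \<delta> where "\<delta> = det (matrix (A c0 x0))"
  define t where "t = trace (matrix (A c0 x0))"
  have const: "det (matrix (A c x)) = \<delta>" "trace (matrix (A c x)) = t" if "c \<in> \<B>" "x \<in> cimg c" for c x
  proof -
    have "proots (charpoly (matrix (A c x))) = proots (charpoly (matrix (A c0 x0)))"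
      using isoparametric that base unfolding isoparametric_def principal_curvatures_def by metis
    from proots_charpoly_determines[OF this]
    show "det (matrix (A c x)) = \<delta>" "trace (matrix (A c x)) = t"
      by (simp_all add: \<delta>_def t_def)
  qed
  have "\<delta> \<noteq> 0"
    using gauss_kronecker[OF base] by (simp add: gauss_kronecker_def \<delta>_def)
  obtain \<gamma> h \<tau> where E: "induced_data \<B> \<A> \<Gamma> F E \<gamma> h A \<tau>"
    using shape by (auto simp: shape_operator_def)
  obtain \<gamma>' k S' \<tau>' where W: "induced_data \<B> \<A> \<Gamma> F W \<gamma>' k S' \<tau>'" "aligned \<B> \<gamma>' k"
    "volume_normalized \<B> \<A> g F W k" "co_oriented \<B> \<A> F N W"
    using equiaffine by (auto simp: equiaffine_normal_def)
  have "mean_curvature S c x = root (CARD('n) + 2) \<bar>\<delta>\<bar> * t / CARD('n)" if c: "c \<in> \<B>" "x \<in> cimg c" for c x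
  proof -
    obtain d where d: "d \<in> \<A>" "x \<in> ldom F c d"
      using ldom_cover[of \<B> \<A> F c x] hypersurface c by (auto simp: hypersurface_def)
    interpret equiaffine_chart \<A> g \<Gamma> d \<B> F N E \<gamma> h A \<tau> c W \<gamma>' k S' \<tau>' \<delta>
      using dim ambient hypersurface normal E W c(1) d(1) \<open>\<delta> \<noteq> 0\<close> const(1)[OF c(1)] ldom_subset[of F c d]
      by unfold_locales auto
    show ?thesis
      using mean_curvature_W[OF d(2) equiaffine_shape] const(2)[OF c] by simp
  qed
  then show ?thesis
    by blast
qed

end
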